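(* Let $f(s)=\sum_{n\ge1} c(n)n^{-s}$ be a Dirichlet series, absolutely convergent for $\sigma\geq 1$, whose logarithm $\log f(s)$ is uniformly bounded for $\sigma\geq 1$. Let $L(s)$ be a Dirichlet series with the following properties: (I) $L(s)=\sum_{n=1}^\infty \frac{a(n)}{n^s}$ is absolutely convergent for $\sigma>1$; (II) $\log L(s)=\sum_p\sum_{k=1}^\infty \frac{b(p^k)}{p^{ks}}$ is absolutely convergent for $\sigma>1$, and there exist $K>0$ and $\theta<1/2$ such that $|b(p^k)|\leq K p^{k\theta}$ for every prime $p$ and every integer $k\geq 1$; (III) $\sum_p |a(p)|p^{-\sigma}\to\infty$ when $\sigma\to 1^+$. Then $L(s)+f(s)$ has infinitely many zeros in the half-plane $\sigma>1$.
   Context: Write $s=\sigma+it$ with $\sigma,t\in\mathbb{R}$. The coefficients $a(n)$, $b(p^k)$, $c(n)$ are complex numbers; $p$ runs over the primes. Condition (II) means that the displayed double series converges absolutely for $\sigma>1$ and that $L(s)$ equals its exponential there; this series defines $\log L(s)$. The hypothesis on $\log f$ means: $f$ has no zeros in $\{\sigma\ge1\}$ and there is a continuous function $\log f$ on $\{\sigma\geq 1\}$ with $\exp(\log f(s))=f(s)$ and a constant $B>0$ such that $|\log f(s)|\le B$ for all $s$ with $\sigma\ge 1$. *)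

theory Defs
  imports "HOL-Analysis.Analysis" "HOL-Computational_Algebra.Primes"
begin

definition dirichlet_term :: "(nat \<Rightarrow> complex) \<Rightarrow> complex \<Rightarrow> nat \<Rightarrow> complex" where
  "dirichlet_term a s n = a n / of_nat n powr s"

definition dirichlet_abs_conv :: "(nat \<Rightarrow> complex) \<Rightarrow> complex \<Rightarrow> bool" where
  "dirichlet_abs_conv a s \<longleftrightarrow> (\<lambda>n. norm (dirichlet_term a s n)) summable_on {1..}"

definition dirichlet_series :: "(nat \<Rightarrow> complex) \<Rightarrow> complex \<Rightarrow> complex" where
  "dirichlet_series a s = (\<Sum>\<^sub>\<infinity>n\<in>{1..}. dirichlet_term a s n)"

(* The double series over primes p and exponents k \<ge> 1 is an unordered sum over the pairs (p, k);
   only the values of b at prime powers enter. *)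

definition prime_exponents :: "(nat \<times> nat) set" where
  "prime_exponents = {p. prime p} \<times> {1..}"

definition log_term :: "(nat \<Rightarrow> complex) \<Rightarrow> complex \<Rightarrow> nat \<times> nat \<Rightarrow> complex" where
  "log_term b s = (\<lambda>(p, k). b (p ^ k) / of_nat p powr (of_nat k * s))"

definition log_abs_conv :: "(nat \<Rightarrow> complex) \<Rightarrow> complex \<Rightarrow> bool" where
  "log_abs_conv b s \<longleftrightarrow> (\<lambda>x. norm (log_term b s x)) summable_on prime_exponents"

definition log_series :: "(nat \<Rightarrow> complex) \<Rightarrow> complex \<Rightarrow> complex" where
  "log_series b s = (\<Sum>\<^sub>\<infinity>x\<in>prime_exponents. log_term b s x)"

definition has_bounded_log_on :: "(complex \<Rightarrow> complex) \<Rightarrow> complex set \<Rightarrow> bool" where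
  "has_bounded_log_on f S \<longleftrightarrow>
     (\<forall>s\<in>S. f s \<noteq> 0) \<and>
     (\<exists>g B. continuous_on S g \<and> (\<forall>s\<in>S. exp (g s) = f s) \<and>
            0 < (B::real) \<and> (\<forall>s\<in>S. norm (g s) \<le> B))"

end

theory Submission
  imports Defs "HOL-Complex_Analysis.Complex_Analysis"
begin

text \<open>
  The proof replaces vertical shifts by twists. If \<open>\<psi>\<close> assigns a number of modulus 1 to every
  prime, Kronecker's theorem gives real \<open>\<tau>\<^sub>j \<rightarrow> \<infinity>\<close> such that \<open>n powr (- \<i> * \<tau>\<^sub>j)\<close> tends, for each
  \<open>n \<ge> 1\<close>, to the value at \<open>n\<close> of the completely multiplicative extension of \<open>\<psi>\<close>
  (\<open>vertical_shifts_to_character\<close>). Hence the shifts of \<open>F = L + f\<close> by \<open>\<i> * \<tau>\<^sub>j\<close> converge, uniformly on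
  every half-plane \<open>Re s \<ge> 1 + \<delta>\<close>, to the Dirichlet series of \<open>F\<close> twisted by \<open>\<psi>\<close>. If this twist
  has a zero, Hurwitz's theorem produces zeros of \<open>F\<close> at arbitrarily large height
  (\<open>infinite_zeros_of_twisted_zero\<close>). It is therefore enough to find a single \<open>\<psi>\<close> and a single real
  \<open>\<sigma> > 1\<close> at which the twist of \<open>L + f\<close> vanishes; unlike the shifts, the values of \<open>\<psi>\<close> at different
  primes can be chosen independently.

  Such a zero is found by a fixed point argument (\<open>twisted_sum_has_zero\<close>). Let \<open>\<beta>\<close> be the coefficient
  function of \<open>log L\<close>. The higher prime powers contribute a bounded amount to \<open>log L\<close> because
  \<open>\<theta> < 1 / 2\<close>, and \<open>\<psi> = 1\<close> is kept on the primes up to some bound \<open>P\<close>, which makes the twist of \<open>f\<close>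
  a small perturbation of \<open>f\<close>. The remaining primes give the sum of \<open>\<beta> p * \<psi> p * p powr (- \<sigma>)\<close>, whose
  terms are bounded while the sum of their moduli tends to infinity as \<open>\<sigma>\<close> decreases to 1. So for
  \<open>\<sigma>\<close> close to 1 the values of \<open>\<psi>\<close> can be chosen as continuous functions of a target \<open>w\<close> in a large
  disc in such a way that this sum, and with it the twisted \<open>log L\<close>, is within a fixed distance of
  \<open>w\<close> (\<open>steer_complex\<close>). Since \<open>log (- f)\<close> is bounded, Brouwer's theorem gives a \<open>w\<close> at which the
  twisted \<open>log L\<close> equals a logarithm of minus the twisted \<open>f\<close>.

  Two facts tie this to the hypotheses: \<open>a p = \<beta> p\<close> for primes \<open>p\<close>, by comparing coefficients in
  \<open>L = exp (log L)\<close> (\<open>coeff_prime_of_exp\<close>), which turns the divergence for \<open>a\<close> into one for \<open>\<beta>\<close>;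
  and \<open>a + c\<close> is not identically zero, because the sum of \<open>norm (c p) * p powr (- \<sigma>)\<close> stays bounded.
\<close>

section \<open>Dirichlet series and bounded twists\<close>

lemma norm_dirichlet_term:
  assumes "n \<ge> 1"
  shows "norm (dirichlet_term a s n) = norm (a n) * real n powr (- Re s)"
  using assms by (simp add: dirichlet_term_def norm_divide norm_powr_real_powr powr_minus divide_simps)

lemma dirichlet_abs_conv_iff:
  "dirichlet_abs_conv a s \<longleftrightarrow> (\<lambda>n. norm (a n) * real n powr (- Re s)) summable_on {1..}"
  unfolding dirichlet_abs_conv_def
  by (rule summable_on_cong) (simp add: norm_dirichlet_term)

lemma dirichlet_abs_conv_dominated:
  assumes "dirichlet_abs_conv a s" "Re s \<le> Re z" "\<And>n. n \<ge> 1 \<Longrightarrow> norm (b n) \<le> norm (a n)"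
  shows "dirichlet_abs_conv b z"
  unfolding dirichlet_abs_conv_iff
proof (rule summable_on_comparison_test)
  show "(\<lambda>n. norm (a n) * real n powr (- Re s)) summable_on {1..}"
    using assms(1) by (simp add: dirichlet_abs_conv_iff)
qed (use assms in \<open>auto intro!: mult_mono powr_mono\<close>)

lemma dirichlet_series_has_sum:
  "dirichlet_abs_conv a s \<Longrightarrow> (dirichlet_term a s has_sum dirichlet_series a s) {1..}"
  unfolding dirichlet_abs_conv_def dirichlet_series_def
  using abs_summable_summable has_sum_infsum by blast

lemma dirichlet_abs_conv_add:
  assumes "dirichlet_abs_conv a s" "dirichlet_abs_conv b s"
  shows "dirichlet_abs_conv (\<lambda>n. a n + b n) s"
  unfolding dirichlet_abs_conv_iff
proof (rule summable_on_comparison_test)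
  show "(\<lambda>n. norm (a n) * real n powr (- Re s) + norm (b n) * real n powr (- Re s)) summable_on {1..}"
    using assms by (intro summable_on_add) (auto simp: dirichlet_abs_conv_iff)
qed (auto simp: norm_triangle_ineq simp flip: distrib_right intro!: mult_right_mono)

lemma dirichlet_series_add:
  assumes "dirichlet_abs_conv a s" "dirichlet_abs_conv b s"
  shows "dirichlet_series (\<lambda>n. a n + b n) s = dirichlet_series a s + dirichlet_series b s"
proof -
  have "((\<lambda>n. dirichlet_term a s n + dirichlet_term b s n) has_sum
          (dirichlet_series a s + dirichlet_series b s)) {1..}"
    using assms by (intro has_sum_add dirichlet_series_has_sum)
  moreover have "dirichlet_term (\<lambda>n. a n + b n) s = (\<lambda>n. dirichlet_term a s n + dirichlet_term b s n)"
    by (rule ext) (simp add: dirichlet_term_def add_divide_distrib)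
  ultimately show ?thesis
    by (metis dirichlet_series_def infsumI)
qed

lemma dirichlet_series_shift:
  "dirichlet_series a (s + z) = dirichlet_series (\<lambda>n. a n * of_nat n powr (- z)) s"
  unfolding dirichlet_series_def dirichlet_term_def
  by (rule infsum_cong) (simp add: powr_add powr_minus divide_simps)

text \<open>
  Near a point of the half-plane the terms are dominated by those at a real point slightly to its
  left, so the series is a locally uniform limit of entire functions.
\<close>

lemma dirichlet_series_holomorphic:
  assumes "\<And>s. Re s > \<sigma> \<Longrightarrow> dirichlet_abs_conv a s"
  shows "dirichlet_series a holomorphic_on {s. Re s > \<sigma>}"
proof (rule holomorphic_on_open[THEN iffD2])
  show op: "open {s. Re s > \<sigma>}" by (rule open_halfspace_Re_gt)
  show "\<forall>s\<in>{s. Re s > \<sigma>}. \<exists>f'. (dirichlet_series a has_field_derivative f') (at s)"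
  proof
    fix s assume "s \<in> {s. Re s > \<sigma>}"
    then obtain r where r: "r > 0" "cball s r \<subseteq> {s. Re s > \<sigma>}"
      using op open_contains_cball by blast
    let ?\<sigma> = "complex_of_real (Re s - r)"
    have s1: "Re ?\<sigma> > \<sigma>"
      using r by (auto simp: subset_iff dist_norm dest!: spec[of _ "s - of_real r"])
    have ge: "Re z \<ge> Re ?\<sigma>" if "z \<in> cball s r" for z
      using that abs_Re_le_cmod[of "s - z"] by (auto simp: dist_norm)
    have "uniform_limit (cball s r) (\<lambda>X z. \<Sum>n\<in>X. dirichlet_term a z n) (dirichlet_series a)
            (finite_subsets_at_top {1..})"
      unfolding dirichlet_series_def
    proof (rule Weierstrass_m_test_general)
      show "(\<lambda>n. norm (a n) * real n powr (- Re ?\<sigma>)) summable_on {1..}"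
        using assms[OF s1] unfolding dirichlet_abs_conv_iff .
      show "norm (dirichlet_term a z n) \<le> norm (a n) * real n powr (- Re ?\<sigma>)"
        if "n \<in> {1..}" "z \<in> cball s r" for n z
        using that ge[OF that(2)] by (auto simp: norm_dirichlet_term intro!: mult_left_mono powr_mono)
    qed
    moreover have "(\<lambda>z. \<Sum>n\<in>X. dirichlet_term a z n) holomorphic_on cball s r"
      if "finite X" "X \<subseteq> {1..}" for X
      unfolding dirichlet_term_def using that
      by (intro holomorphic_intros) (auto simp: powr_def)
    then have "\<forall>\<^sub>F X in finite_subsets_at_top {1..}.
        continuous_on (cball s r) (\<lambda>z. \<Sum>n\<in>X. dirichlet_term a z n) \<and>
        (\<lambda>z. \<Sum>n\<in>X. dirichlet_term a z n) holomorphic_on ball s r"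
      by (intro eventually_finite_subsets_at_top_weakI)
         (meson ball_subset_cball holomorphic_on_imp_continuous_on holomorphic_on_subset)
    ultimately have "dirichlet_series a holomorphic_on ball s r"
      using holomorphic_uniform_limit by (metis finite_subsets_at_top_neq_bot)
    then show "\<exists>f'. (dirichlet_series a has_field_derivative f') (at s)"
      using r(1) by (meson centre_in_ball holomorphic_on_open open_ball)
  qed
qed

text \<open>
  Dominated convergence: outside a finite set of indices the absolute series at \<open>z\<close> is small,
  and on that finite set the multipliers converge. This one statement yields the convergence of
  vertical shifts to a twist as well as the continuity of a twist in its parameters.
\<close>

lemma dirichlet_series_twist_uniform_limit:
  fixes X :: "nat \<Rightarrow> nat \<Rightarrow> complex"
  assumes conv: "dirichlet_abs_conv a z"
    and bound: "\<And>j n. n \<ge> 1 \<Longrightarrow> norm (X j n) \<le> 1"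
    and lim: "\<And>n. n \<ge> 1 \<Longrightarrow> (\<lambda>j. X j n) \<longlonglongrightarrow> Y n"
  shows "uniform_limit {s. Re s \<ge> Re z} (\<lambda>j. dirichlet_series (\<lambda>n. a n * X j n))
           (dirichlet_series (\<lambda>n. a n * Y n)) sequentially"
proof (rule uniform_limitI)
  fix e :: real assume e: "e > 0"
  define r where "r = (\<lambda>n. norm (a n) * real n powr (- Re z))"
  have r: "r summable_on {1..}" "\<And>n. r n \<ge> 0"
    using conv by (auto simp: dirichlet_abs_conv_iff r_def)
  have Y: "norm (Y n) \<le> 1" if "n \<ge> 1" for n
    using that bound lim by (intro tendsto_upperbound[OF tendsto_norm[OF lim]]) auto
  obtain F where F: "finite F" "F \<subseteq> {1..}" "\<bar>infsum r {1..} - sum r F\<bar> \<le> e / 8"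
    using infsum_finite_approximation[OF r(1), of "e/8"] e by (auto simp: dist_real_def abs_minus_commute)
  have tail: "infsum r ({1..} - F) \<le> e / 8"
  proof -
    have "infsum r ({1..} - F) = infsum r {1..} - sum r F"
      using infsum_Diff[OF r(1) _ F(2)] F(1) by simp
    then show ?thesis using F(3) by linarith
  qed
  have "(\<lambda>j. \<Sum>n\<in>F. r n * norm (X j n - Y n)) \<longlonglongrightarrow> (\<Sum>n\<in>F. r n * norm (Y n - Y n))"
    using F by (intro tendsto_intros lim) auto
  then have "\<forall>\<^sub>F j in sequentially. (\<Sum>n\<in>F. r n * norm (X j n - Y n)) < e / 2"
    using e by (intro order_tendstoD(2)) auto
  then show "\<forall>\<^sub>F j in sequentially. \<forall>s\<in>{s. Re s \<ge> Re z}.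
     dist (dirichlet_series (\<lambda>n. a n * X j n) s) (dirichlet_series (\<lambda>n. a n * Y n) s) < e"
  proof eventually_elim
    case (elim j)
    show ?case
    proof
      fix s assume "s \<in> {s. Re s \<ge> Re z}"
      then have s: "Re s \<ge> Re z" by simp
      let ?D = "dirichlet_series (\<lambda>n. a n * X j n) s - dirichlet_series (\<lambda>n. a n * Y n) s"
      define d where "d = (\<lambda>n. dirichlet_term (\<lambda>n. a n * (X j n - Y n)) s n)"
      have c: "dirichlet_abs_conv (\<lambda>n. a n * X j n) s" "dirichlet_abs_conv (\<lambda>n. a n * Y n) s"
        using bound Y by (auto intro!: dirichlet_abs_conv_dominated[OF conv s]
                               simp: norm_mult mult_left_le)
      have "((\<lambda>n. dirichlet_term (\<lambda>n. a n * X j n) s n - dirichlet_term (\<lambda>n. a n * Y n) s n) has_sum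
         ?D) {1..}"
        using has_sum_add[OF dirichlet_series_has_sum[OF c(1)] has_sum_uminusI[OF dirichlet_series_has_sum[OF c(2)]]]
        by simp
      then have hs: "(d has_sum
         ?D) {1..}"
        by (simp add: d_def dirichlet_term_def diff_divide_distrib right_diff_distrib)
      have dle: "norm (d n) \<le> r n * norm (X j n - Y n)" if "n \<ge> 1" for n
        using that s by (auto simp: d_def r_def norm_dirichlet_term norm_mult mult_ac
            intro!: mult_left_mono mult_right_mono powr_mono)
      have dle2: "norm (d n) \<le> 2 * r n" if "n \<in> {1..} - F" for n
      proof -
        have "norm (X j n - Y n) \<le> 1 + 1"
          using that bound Y by (intro norm_triangle_le_diff add_mono) auto
        then have "r n * norm (X j n - Y n) \<le> r n * 2"
          using r(2) by (intro mult_left_mono) auto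
        then show ?thesis using dle[of n] that by auto
      qed
      have "(d has_sum ?D - sum d F) ({1..} - F)"
        using hs F by (intro has_sum_Diff has_sum_finite) auto
      moreover have "((\<lambda>n. 2 * r n) has_sum (2 * infsum r ({1..} - F))) ({1..} - F)"
        using r F by (intro has_sum_cmult_right has_sum_infsum summable_on_Diff) auto
      ultimately have "norm (?D - sum d F)
          \<le> 2 * infsum r ({1..} - F)"
        using norm_infsum_le dle2 by blast
      also have "\<dots> \<le> e / 4" using tail by simp
      finally have 1: "norm (?D - sum d F) \<le> e / 4" .
      have 2: "norm (sum d F) < e / 2"
        using F(2) by (intro order.strict_trans1[OF _ elim] sum_norm_le dle) auto
      show "dist (dirichlet_series (\<lambda>n. a n * X j n) s) (dirichlet_series (\<lambda>n. a n * Y n) s) < e"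
        using norm_triangle_sub[of ?D "sum d F"] 1 2 e
        by (simp add: dist_norm)
    qed
  qed
qed

lemma dirichlet_series_twist_tendsto:
  fixes X :: "nat \<Rightarrow> nat \<Rightarrow> complex"
  assumes conv: "dirichlet_abs_conv a s"
    and bound: "\<And>j n. n \<ge> 1 \<Longrightarrow> norm (X j n) \<le> 1"
    and lim: "\<And>n. n \<ge> 1 \<Longrightarrow> (\<lambda>j. X j n) \<longlonglongrightarrow> Y n"
  shows "(\<lambda>j. dirichlet_series (\<lambda>n. a n * X j n) s) \<longlonglongrightarrow> dirichlet_series (\<lambda>n. a n * Y n) s"
  using dirichlet_series_twist_uniform_limit[where a=a and z=s and X=X and Y=Y, OF assms]
  by (rule tendsto_uniform_limitI) auto

text \<open>
  For the least index \<open>n\<close> still in question, \<open>n powr x\<close> times the series at \<open>x\<close> tends to \<open>a n\<close> as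
  \<open>x\<close> grows, since the later terms decay at least as fast as \<open>(n / (n + 1)) powr (x - \<sigma>)\<close>.
\<close>

lemma dirichlet_series_eq_0_imp_coeff_0:
  assumes conv: "dirichlet_abs_conv a (of_real \<sigma>)"
    and zero: "\<And>x. x \<ge> \<sigma> \<Longrightarrow> dirichlet_series a (of_real x) = 0"
    and "n \<ge> 1"
  shows "a n = 0"
  using \<open>n \<ge> 1\<close>
proof (induction n rule: less_induct)
  case (less n)
  define S where "S = infsum (\<lambda>m. norm (a m) * real m powr (- \<sigma>)) {1..}"
  have sm: "(\<lambda>m. norm (a m) * real m powr (- \<sigma>)) summable_on {1..}"
    using conv by (simp add: dirichlet_abs_conv_iff)
  have S0: "S \<ge> 0" unfolding S_def by (intro infsum_nonneg) auto
  have bd: "norm (a n) * real n powr (- \<sigma>) \<le> (real n / real (n + 1)) powr (x - \<sigma>) * S" if x: "x \<ge> \<sigma>" for x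
  proof -
    let ?k = "real n powr (\<sigma> - x) * (real n / real (n + 1)) powr (x - \<sigma>)"
    have "(dirichlet_term a (of_real x) has_sum 0) {1..}"
      using dirichlet_series_has_sum[OF dirichlet_abs_conv_dominated[OF conv, of "of_real x" a]] x zero[OF x] by auto
    then have "(dirichlet_term a (of_real x) has_sum (0 - sum (dirichlet_term a (of_real x)) {n})) ({1..} - {n})"
      using less.prems by (intro has_sum_Diff has_sum_finite) auto
    moreover have "((\<lambda>m. ?k * (norm (a m) * real m powr (- \<sigma>))) has_sum
         (?k * (infsum (\<lambda>m. norm (a m) * real m powr (- \<sigma>)) ({1..} - {n})))) ({1..} - {n})"
      by (intro has_sum_cmult_right has_sum_infsum summable_on_subset[OF sm]) auto
    moreover have "norm (dirichlet_term a (of_real x) m) \<le> ?k * (norm (a m) * real m powr (- \<sigma>))"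
      if m: "m \<in> {1..} - {n}" for m
    proof (cases "m < n")
      case True
      then have "a m = 0" using m less.IH by auto
      then show ?thesis by (simp add: dirichlet_term_def)
    next
      case False
      then have mn: "real m \<ge> real (n + 1)" using m by auto
      have "real m powr (- x) = real m powr (- \<sigma>) * real m powr (\<sigma> - x)"
        using m by (simp flip: powr_add)
      also have "\<dots> \<le> real m powr (- \<sigma>) * real (n + 1) powr (\<sigma> - x)"
        using mn x by (intro mult_left_mono powr_mono2') auto
      also have "real (n + 1) powr (\<sigma> - x) = real n powr (\<sigma> - x) * (real n / real (n + 1)) powr (x - \<sigma>)"
        using less.prems by (simp add: powr_divide powr_diff divide_simps)
      finally have "norm (a m) * real m powr (- x) \<le> norm (a m) * (real m powr (- \<sigma>) * ?k)"
        by (intro mult_left_mono) auto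
      then show ?thesis using m by (simp add: norm_dirichlet_term mult_ac)
    qed
    ultimately have "norm (0 - sum (dirichlet_term a (of_real x)) {n}) \<le>
       ?k * (infsum (\<lambda>m. norm (a m) * real m powr (- \<sigma>)) ({1..} - {n}))"
      by (rule norm_infsum_le) auto
    also have "\<dots> \<le> ?k * S"
      unfolding S_def
      by (intro mult_left_mono infsum_mono_neutral sm summable_on_subset[OF sm]) auto
    finally have "norm (a n) * real n powr (- x) \<le> ?k * S"
      using less.prems by (simp add: norm_dirichlet_term)
    moreover have "real n powr (- x) = real n powr (\<sigma> - x) * real n powr (- \<sigma>)"
      using less.prems by (simp flip: powr_add)
    ultimately have "real n powr (\<sigma> - x) * (norm (a n) * real n powr (- \<sigma>)) \<le> real n powr (\<sigma> - x) * ((real n / real (n + 1)) powr (x - \<sigma>) * S)"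
      by (simp add: mult_ac)
    moreover have "real n powr (\<sigma> - x) > 0" using less.prems by simp
    ultimately show ?thesis by (simp only: mult_le_cancel_left_pos)
  qed
  have q: "0 < real n / real (n + 1)" "real n / real (n + 1) < 1" using less.prems by auto
  have "((\<lambda>k. (real n / real (n + 1)) ^ k * S) \<longlonglongrightarrow> 0 * S)"
    using q by (intro tendsto_intros LIMSEQ_power_zero) auto
  moreover have "norm (a n) * real n powr (- \<sigma>) \<le> (real n / real (n + 1)) ^ k * S" for k
    using bd[of "\<sigma> + real k"] q less.prems by (simp add: powr_realpow)
  ultimately have "norm (a n) * real n powr (- \<sigma>) \<le> 0"
    by (intro tendsto_lowerbound[of "\<lambda>k. (real n / real (n + 1)) ^ k * S"]) auto
  then show ?case using less.prems by (simp add: mult_le_0_iff)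
qed

section \<open>The exponential of a Dirichlet series\<close>

lemma has_sum_product_abs:
  fixes f :: "'i \<Rightarrow> 'a::{real_normed_field,banach}" and g :: "'j \<Rightarrow> 'a"
  assumes "(f has_sum a) A" "(\<lambda>i. norm (f i)) summable_on A"
    and "(g has_sum b) B" "(\<lambda>j. norm (g j)) summable_on B"
  shows "((\<lambda>(i, j). f i * g j) has_sum a * b) (A \<times> B)"
    and "(\<lambda>x. norm (case x of (i, j) \<Rightarrow> f i * g j)) summable_on A \<times> B"
proof -
  show *: "(\<lambda>x. norm (case x of (i, j) \<Rightarrow> f i * g j)) summable_on A \<times> B"
  proof (rule summable_on_SigmaI)
    show "((\<lambda>y. norm (case (x, y) of (i, j) \<Rightarrow> f i * g j)) has_sum norm (f x) * infsum (\<lambda>j. norm (g j)) B) B" for x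
      using has_sum_cmult_right[OF has_sum_infsum[OF assms(4)]] by (simp add: norm_mult)
    show "(\<lambda>x. norm (f x) * infsum (\<lambda>j. norm (g j)) B) summable_on A"
      by (intro summable_on_cmult_left assms)
  qed auto
  show "((\<lambda>(i, j). f i * g j) has_sum a * b) (A \<times> B)"
  proof (rule has_sum_SigmaI)
    show "((\<lambda>y. case (x, y) of (i, j) \<Rightarrow> f i * g j) has_sum f x * b) B" for x
      using has_sum_cmult_right[OF assms(3)] by simp
    show "((\<lambda>x. f x * b) has_sum a * b) A"
      by (rule has_sum_cmult_left[OF assms(1)])
    show "(\<lambda>(i, j). f i * g j) summable_on A \<times> B"
      using * by (rule abs_summable_summable)
  qed
qed

lemma has_sum_power_lists:
  fixes f :: "'i \<Rightarrow> 'a::{real_normed_field,banach}"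
  assumes "(f has_sum a) A" "(\<lambda>i. norm (f i)) summable_on A"
  shows "((\<lambda>l. prod_list (map f l)) has_sum a ^ k) {l. length l = k \<and> set l \<subseteq> A} \<and>
         (\<lambda>l. norm (prod_list (map f l))) summable_on {l. length l = k \<and> set l \<subseteq> A}"
proof (induction k)
  case 0
  have "{l. length l = 0 \<and> set l \<subseteq> A} = {[]}" by auto
  then show ?case by (simp add: has_sum_finite_iff)
next
  case (Suc k)
  let ?L = "\<lambda>k. {l. length l = k \<and> set l \<subseteq> A}"
  have bij: "bij_betw (\<lambda>(i, l). i # l) (A \<times> ?L k) (?L (Suc k))"
    by (rule bij_betwI[of _ _ _ "\<lambda>l. (hd l, tl l)"]) (auto simp: length_Suc_conv)
  have eq: "(\<lambda>x. prod_list (map f (case x of (i, l) \<Rightarrow> i # l))) = (\<lambda>(i, l). f i * prod_list (map f l))"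
    by auto
  note P = has_sum_product_abs[OF assms conjunct1[OF Suc] conjunct2[OF Suc]]
  show ?case
    using P has_sum_reindex_bij_betw[OF bij, of "\<lambda>l. prod_list (map f l)" "a ^ Suc k"]
      summable_on_reindex_bij_betw[OF bij, of "\<lambda>l. norm (prod_list (map f l))"]
    unfolding eq by (simp add: case_prod_unfold)
qed

text \<open>
  Expanding each power in the exponential series turns the exponential of an unordered sum into an
  unordered sum over finite sequences of indices. The sequences carry their length as a first
  component so that the total is an iterated sum over the length.
\<close>

lemma exp_has_sum_lists:
  fixes f :: "'i \<Rightarrow> complex"
  assumes "(f has_sum a) A" "(\<lambda>i. norm (f i)) summable_on A"
  defines "J \<equiv> (SIGMA k:UNIV. {l. length l = k \<and> set l \<subseteq> A})"
  shows "((\<lambda>(k, l). prod_list (map f l) / fact k) has_sum exp a) J"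
    and "(\<lambda>(k, l). norm (prod_list (map f l) / fact k)) summable_on J"
proof -
  have exp_sum: "((\<lambda>k. b ^ k / fact k) has_sum exp b) UNIV" for b :: complex
    using exp_converges[of b] summable_norm_exp[of b]
    by (intro norm_summable_imp_has_sum) (simp_all add: scaleR_conv_of_real divide_inverse mult.commute)
  have exp_sumr: "(\<lambda>k. b ^ k / fact k) summable_on UNIV" if "b \<ge> 0" for b :: real
    using summable_exp[of b] that
    by (intro norm_summable_imp_summable_on) (simp add: divide_inverse mult.commute)
  show *: "(\<lambda>(k, l). norm (prod_list (map f l) / fact k)) summable_on J"
    unfolding J_def
  proof (rule summable_on_SigmaI)
    let ?b = "infsum (\<lambda>i. norm (f i)) A"
    have nrm: "norm (prod_list (map f l)) = prod_list (map (\<lambda>i. norm (f i)) l)" for l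
      by (induction l) (auto simp: norm_mult)
    show "((\<lambda>y. case (k, y) of (k, l) \<Rightarrow> norm (prod_list (map f l) / fact k)) has_sum ?b ^ k / fact k)
            {l. length l = k \<and> set l \<subseteq> A}" for k
      using has_sum_power_lists[of "\<lambda>i. norm (f i)" A ?b k] assms(2)
      by (simp add: norm_divide nrm has_sum_divide_const)
    show "(\<lambda>k. ?b ^ k / fact k) summable_on UNIV"
      by (intro exp_sumr infsum_nonneg) auto
  qed auto
  show "((\<lambda>(k, l). prod_list (map f l) / fact k) has_sum exp a) J"
    unfolding J_def
  proof (rule has_sum_SigmaI)
    show "((\<lambda>y. case (k, y) of (k, l) \<Rightarrow> prod_list (map f l) / fact k) has_sum a ^ k / fact k)
            {l. length l = k \<and> set l \<subseteq> A}" for k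
      using has_sum_power_lists[OF assms(1,2), of k] by (simp add: has_sum_divide_const)
    show "((\<lambda>k. a ^ k / fact k) has_sum exp a) UNIV" by (rule exp_sum)
    show "(\<lambda>(k, l). prod_list (map f l) / fact k) summable_on (SIGMA k:UNIV. {l. length l = k \<and> set l \<subseteq> A})"
      using * unfolding J_def by (rule abs_summable_summable[OF iffD1[OF summable_on_cong], rotated]) auto
  qed
qed

text \<open>
  The index set of the expansion of the exponential: ordered factorizations of \<open>n\<close> into factors
  \<open>\<ge> 2\<close>, tagged with their length.
\<close>

definition factorizations :: "nat \<Rightarrow> (nat \<times> nat list) set" where
  "factorizations n = {(k, l). length l = k \<and> set l \<subseteq> {2..} \<and> prod_list l = n}"

text \<open>
  The coefficients of the formal exponential of a Dirichlet series without constant term.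
\<close>

definition exp_coeff :: "(nat \<Rightarrow> complex) \<Rightarrow> nat \<Rightarrow> complex" where
  "exp_coeff \<beta> n = infsum (\<lambda>(k, l). prod_list (map \<beta> l) / fact k) (factorizations n)"

lemma factorizations_prime:
  assumes "prime p"
  shows "factorizations p = {(1, [p])}"
proof -
  have nil: "l = []" if "set l \<subseteq> {2..}" "prod_list l = (1::nat)" for l
    using that by (cases l) auto
  have "l = [p]" if l: "set l \<subseteq> {2..}" "prod_list l = p" for l
  proof (cases l)
    case Nil
    then show ?thesis using l assms by auto
  next
    case (Cons x l')
    then have p: "x * prod_list l' = p" and x: "x \<noteq> 1" and l': "set l' \<subseteq> {2..}"
      using l by auto
    have "prod_list l' = 1"
      using prime_product[of x "prod_list l'"] p x assms by simp
    then show ?thesis using nil[OF l'] p Cons by simp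
  qed
  then show ?thesis
    using prime_ge_2_nat[OF assms] unfolding factorizations_def
    by (intro equalityI subsetI; clarsimp) (metis length_Cons list.size(3) One_nat_def)
qed

text \<open>
  The list expansion of the exponential, with the lists grouped by their product.
\<close>

lemma exp_dirichlet_series:
  assumes conv: "dirichlet_abs_conv \<beta> s" and \<beta>1: "\<beta> 1 = 0"
  shows "dirichlet_abs_conv (exp_coeff \<beta>) s"
    and "dirichlet_series (exp_coeff \<beta>) s = exp (dirichlet_series \<beta> s)"
proof -
  let ?t = "dirichlet_term \<beta> s"
  define J where "J = (SIGMA k:UNIV. {l. length l = k \<and> set l \<subseteq> {2::nat..}})"
  define v where "v = (\<lambda>(k::nat, l). prod_list (map ?t l) / fact k)"
  define w where "w = (\<lambda>(k::nat, l). prod_list (map \<beta> l) / fact k)"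
  have t: "(?t has_sum dirichlet_series \<beta> s) {2..}"
    using dirichlet_series_has_sum[OF conv]
    by (rule has_sum_cong_neutral[THEN iffD1, rotated -1])
       (use \<beta>1 in \<open>auto simp: dirichlet_term_def not_le less_Suc_eq numeral_2_eq_2\<close>)
  have tn: "(\<lambda>n. norm (?t n)) summable_on {2..}"
    using conv unfolding dirichlet_abs_conv_def by (rule summable_on_subset) auto
  have v: "(v has_sum exp (dirichlet_series \<beta> s)) J" "(\<lambda>x. norm (v x)) summable_on J"
    using exp_has_sum_lists[OF t tn] by (auto simp: v_def J_def case_prod_unfold)
  have pos: "prod_list l \<ge> 1" if "set l \<subseteq> {2::nat..}" for l
    using that by (induction l) auto
  have bij: "bij_betw snd (SIGMA n:{1..}. factorizations n) J"
    by (rule bij_betwI[of _ _ _ "\<lambda>(k, l). (prod_list l, (k, l))"])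
       (use pos in \<open>auto simp: J_def factorizations_def\<close>)
  have vw: "v x = w x / of_nat n powr s" if "x \<in> factorizations n" for x n
  proof -
    have "prod_list (map ?t l) = prod_list (map \<beta> l) / of_nat (prod_list l) powr s" for l
      by (induction l) (auto simp: dirichlet_term_def powr_times_real)
    then show ?thesis using that by (auto simp: v_def w_def factorizations_def)
  qed
  have V: "((\<lambda>x. v (snd x)) has_sum exp (dirichlet_series \<beta> s)) (SIGMA n:{1..}. factorizations n)"
    using has_sum_reindex_bij_betw[OF bij] v(1) by blast
  have Vn: "(\<lambda>x. norm (v (snd x))) summable_on (SIGMA n:{1..}. factorizations n)"
    using summable_on_reindex_bij_betw[OF bij, of "\<lambda>x. norm (v x)"] v(2) by blast
  have vn: "(\<lambda>x. norm (v x)) summable_on factorizations n" if "n \<ge> 1" for n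
    using summable_on_SigmaD1[of "\<lambda>n x. norm (v x)" "{1..}" factorizations n] Vn that
    by (simp add: case_prod_unfold)
  have inner: "(v has_sum dirichlet_term (exp_coeff \<beta>) s n) (factorizations n)" if n: "n \<ge> 1" for n
  proof -
    have "(v has_sum infsum v (factorizations n)) (factorizations n)"
      using vn[OF n] abs_summable_summable has_sum_infsum by blast
    moreover have "infsum v (factorizations n) = infsum (\<lambda>x. w x * inverse (of_nat n powr s)) (factorizations n)"
      by (rule infsum_cong) (simp add: vw divide_inverse)
    moreover have "\<dots> = infsum w (factorizations n) * inverse (of_nat n powr s)"
      using n by (subst infsum_cmult_left') auto
    moreover have "infsum w (factorizations n) = exp_coeff \<beta> n"
      by (simp add: w_def exp_coeff_def)
    ultimately show ?thesis by (simp add: dirichlet_term_def divide_inverse)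
  qed
  have "(dirichlet_term (exp_coeff \<beta>) s has_sum exp (dirichlet_series \<beta> s)) {1..}"
    using V by (rule has_sum_SigmaD) (use inner in auto)
  then show "dirichlet_series (exp_coeff \<beta>) s = exp (dirichlet_series \<beta> s)"
    unfolding dirichlet_series_def by (rule infsumI)
  show "dirichlet_abs_conv (exp_coeff \<beta>) s"
    unfolding dirichlet_abs_conv_def
  proof (rule summable_on_comparison_test)
    show "(\<lambda>n. infsum (\<lambda>x. norm (v x)) (factorizations n)) summable_on {1..}"
      using summable_on_SigmaD[OF Vn] vn by simp
    show "norm (dirichlet_term (exp_coeff \<beta>) s n) \<le> infsum (\<lambda>x. norm (v x)) (factorizations n)"
      if "n \<in> {1..}" for n
      using norm_infsum_bound[OF vn[of n]] infsumI[OF inner[of n]] that by simp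
  qed auto
qed

text \<open>
  The only factorization of a prime is the prime itself, so only the linear term of the exponential
  series reaches the coefficient at a prime.
\<close>

lemma coeff_prime_of_exp:
  assumes a: "\<And>s. Re s > 1 \<Longrightarrow> dirichlet_abs_conv a s"
    and \<beta>: "\<And>s. Re s > 1 \<Longrightarrow> dirichlet_abs_conv \<beta> s" and \<beta>1: "\<beta> 1 = 0"
    and eq: "\<And>s. Re s > 1 \<Longrightarrow> dirichlet_series a s = exp (dirichlet_series \<beta> s)"
    and p: "prime p"
  shows "a p = \<beta> p"
proof -
  have e: "dirichlet_abs_conv (\<lambda>n. - exp_coeff \<beta> n) s" if "Re s > 1" for s
    using exp_dirichlet_series(1)[OF \<beta>[OF that] \<beta>1] by (rule dirichlet_abs_conv_dominated) auto
  have neg: "dirichlet_series (\<lambda>n. - exp_coeff \<beta> n) s = - dirichlet_series (exp_coeff \<beta>) s" for s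
    unfolding dirichlet_series_def dirichlet_term_def
    by (simp flip: infsum_uminus)
  have "a p + - exp_coeff \<beta> p = 0"
  proof (rule dirichlet_series_eq_0_imp_coeff_0[where a = "\<lambda>n. a n + - exp_coeff \<beta> n" and \<sigma> = 2])
    show "dirichlet_abs_conv (\<lambda>n. a n + - exp_coeff \<beta> n) (of_real 2)"
      by (intro dirichlet_abs_conv_add a e) auto
    show "dirichlet_series (\<lambda>n. a n + - exp_coeff \<beta> n) (of_real x) = 0" if "x \<ge> 2" for x
      using that by (subst dirichlet_series_add) (auto intro!: a e simp: neg eq exp_dirichlet_series(2)[OF \<beta> \<beta>1])
    show "p \<ge> 1" using p prime_ge_1_nat by blast
  qed
  moreover have "exp_coeff \<beta> p = \<beta> p"
    by (simp add: exp_coeff_def factorizations_prime[OF p])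
  ultimately show ?thesis by simp
qed

section \<open>Twists as limits of vertical shifts\<close>

text \<open>
  On the positive integers, the completely multiplicative function with the given values at the primes.
\<close>

definition mult_ext :: "(nat \<Rightarrow> complex) \<Rightarrow> nat \<Rightarrow> complex" where
  "mult_ext \<psi> n = (\<Prod>p\<in>prime_factors n. \<psi> p ^ multiplicity p n)"

lemma norm_mult_ext:
  assumes "\<And>p. prime p \<Longrightarrow> norm (\<psi> p) = 1"
  shows "norm (mult_ext \<psi> n) = 1"
  unfolding mult_ext_def
  by (auto simp: prod_norm[symmetric] norm_power assms in_prime_factors_iff intro!: prod.neutral)

lemma mult_ext_prime:
  assumes "prime p"
  shows "mult_ext \<psi> p = \<psi> p"
  using assms by (simp add: mult_ext_def prime_prime_factors)

lemma of_nat_powr_eq_exp: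
  "n > 0 \<Longrightarrow> of_nat n powr (z::complex) = exp (z * of_real (ln (real n)))"
  by (simp add: powr_def Ln_of_nat)

text \<open>
  Taking \<open>z = - \<i> * t\<close> shows that shifting a Dirichlet series by \<open>\<i> * t\<close> is a twist, by the values
  \<open>p powr (- \<i> * t)\<close> at the primes.
\<close>

lemma of_nat_powr_eq_mult_ext:
  assumes "n > 0"
  shows "of_nat n powr z = mult_ext (\<lambda>p. of_nat p powr z) n"
proof -
  have "ln (real n) = ln (real (\<Prod>p\<in>prime_factors n. p ^ multiplicity p n))"
    by (rule arg_cong[OF prime_factorization_nat[OF assms]])
  also have "\<dots> = (\<Sum>p\<in>prime_factors n. real (multiplicity p n) * ln (real p))"
    unfolding of_nat_prod
    by (subst ln_prod) (auto simp: ln_realpow in_prime_factors_iff prime_gt_0_nat)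
  finally have ln: "ln (real n) = (\<Sum>p\<in>prime_factors n. real (multiplicity p n) * ln (real p))" .
  have "of_nat n powr z = exp (\<Sum>p\<in>prime_factors n. of_nat (multiplicity p n) * (z * of_real (ln (real p))))"
    using assms by (simp add: of_nat_powr_eq_exp ln sum_distrib_left mult_ac)
  also have "\<dots> = (\<Prod>p\<in>prime_factors n. exp (z * of_real (ln (real p))) ^ multiplicity p n)"
    by (simp add: exp_sum exp_of_nat_mult)
  also have "\<dots> = mult_ext (\<lambda>p. of_nat p powr z) n"
    unfolding mult_ext_def
    by (intro prod.cong refl) (simp add: of_nat_powr_eq_exp in_prime_factors_iff prime_gt_0_nat)
  finally show ?thesis .
qed

text \<open>
  Unique factorization: an integral relation, after moving the negative coefficients to the other
  side, equates two products of prime powers.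
\<close>

lemma ln_primes_independent:
  fixes u :: "nat \<Rightarrow> int"
  assumes S: "finite S" "\<And>p. p \<in> S \<Longrightarrow> prime p"
    and sum: "(\<Sum>p\<in>S. real_of_int (u p) * ln (real p)) = 0" and p: "p \<in> S"
  shows "u p = 0"
proof -
  define P where "P = (\<lambda>v::nat \<Rightarrow> int. (\<Prod>p\<in>S. p ^ nat (v p)))"
  have pos: "P v > 0" for v
    using S by (auto simp: P_def prime_gt_0_nat intro!: prod_pos)
  have ln: "ln (real (P v)) = (\<Sum>p\<in>S. real (nat (v p)) * ln (real p))" for v
    unfolding P_def of_nat_prod using S
    by (subst ln_prod) (auto simp: ln_realpow prime_gt_0_nat)
  have parts: "real (nat i) - real (nat (- i)) = real_of_int i" for i
    by (cases "i \<ge> 0") auto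
  have "ln (real (P u)) - ln (real (P (\<lambda>p. - u p))) = (\<Sum>p\<in>S. real_of_int (u p) * ln (real p))"
    unfolding ln sum_subtractf[symmetric]
    by (intro sum.cong refl) (simp add: parts flip: left_diff_distrib)
  then have "P u = P (\<lambda>p. - u p)"
    using pos sum by simp
  moreover have "multiplicity p (P v) = nat (v p)" for v
    unfolding P_def using S p by (subst multiplicity_prod_prime_powers) auto
  ultimately have "nat (u p) = nat (- u p)" by metis
  then show ?thesis by simp
qed

lemma norm_exp_i_minus_1_le: "norm (exp (\<i> * of_real x) - 1) \<le> \<bar>x\<bar>"
  using abs_sin_x_le_abs_x[of "x / 2"] by (simp add: dist_exp_i_1)

text \<open>
  Kronecker's theorem, applied to the linearly independent numbers \<open>ln p / (2 * pi)\<close>, gives some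
  \<open>t\<close> without control of its size. Adding a large almost-period, which Dirichlet's theorem on
  simultaneous approximation provides, pushes it beyond \<open>T\<close> at the cost of a second error \<open>\<delta>\<close>.
\<close>

lemma kronecker_primes:
  assumes A: "finite A" "\<And>p. p \<in> A \<Longrightarrow> prime p"
    and \<psi>: "\<And>p. p \<in> A \<Longrightarrow> norm (\<psi> p) = 1" and e: "\<epsilon> > 0"
  shows "\<exists>t\<ge>T. \<forall>p\<in>A. norm (of_nat p powr (- \<i> * of_real t) - \<psi> p) < \<epsilon>"
proof -
  obtain g where g: "bij_betw g {..<card A} A"
    using A(1) ex_bij_betw_nat_finite[of A] by (auto simp: atLeast0LessThan)
  define n where "n = card A"
  define \<phi> where "\<phi> = (\<lambda>p::nat. ln (real p) / (2 * pi))"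
  define \<theta> where "\<theta> = (\<lambda>i. \<phi> (g i))"
  define \<alpha> where "\<alpha> = (\<lambda>i. - Arg (\<psi> (g i)) / (2 * pi))"
  define \<delta> where "\<delta> = \<epsilon> / (4 * pi)"
  have \<delta>: "\<delta> > 0" using e by (simp add: \<delta>_def)
  have gA: "g i \<in> A" if "i < n" for i
    using g that by (auto simp: n_def bij_betw_def)
  have inj\<phi>: "inj_on \<phi> A"
    using A(2) prime_gt_0_nat by (intro inj_onI) (auto simp: \<phi>_def)
  have inj\<theta>: "inj_on \<theta> {..<n}"
    unfolding \<theta>_def using g inj\<phi> comp_inj_on[of g "{..<n}" \<phi>] by (auto simp: bij_betw_def n_def o_def)
  interpret Modules.module "\<lambda>r. (*) (real_of_int r)"
    by (simp add: Modules.module.intro distrib_left mult.commute)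
  have img: "\<theta> ` {..<n} = \<phi> ` A"
    using g by (auto simp: \<theta>_def n_def bij_betw_def image_image[symmetric])
  have indp: "independent (\<theta> ` {..<n})"
    unfolding independent_explicit_module
  proof (intro allI impI)
    fix t u v assume t: "finite t" "t \<subseteq> \<theta> ` {..<n}" and z: "(\<Sum>v\<in>t. real_of_int (u v) * v) = 0" and v: "v \<in> t"
    define S where "S = {p \<in> A. \<phi> p \<in> t}"
    have tS: "t = \<phi> ` S" using t(2) unfolding img S_def by auto
    have "(\<Sum>p\<in>S. real_of_int (u (\<phi> p)) * \<phi> p) = 0"
      using z unfolding tS using inj\<phi>
      by (subst (asm) sum.reindex) (auto simp: S_def inj_on_def)
    then have "(\<Sum>p\<in>S. real_of_int (u (\<phi> p)) * ln (real p)) / (2 * pi) = 0"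
      unfolding sum_divide_distrib by (simp add: \<phi>_def)
    then have "(\<Sum>p\<in>S. real_of_int (u (\<phi> p)) * ln (real p)) = 0" by simp
    then have "u (\<phi> p) = 0" if "p \<in> S" for p
      using ln_primes_independent[of S "\<lambda>p. u (\<phi> p)"] A that by (auto simp: S_def)
    then show "u v = 0" using v tS by auto
  qed
  obtain t h where t: "\<And>i. i < n \<Longrightarrow> \<bar>t * \<theta> i - of_int (h i) - \<alpha> i\<bar> < \<delta>"
    using Kronecker_thm_1[OF indp inj\<theta> \<delta>] by blast
  define M where "M = nat \<lceil>\<bar>T\<bar> + \<bar>t\<bar>\<rceil> + 1"
  define N where "N = nat \<lceil>1 / \<delta>\<rceil> + 1"
  obtain q k where q: "0 < q" and k: "\<And>i. i < n \<Longrightarrow> \<bar>of_int q * (M * \<theta> i) - of_int (k i)\<bar> < 1 / N"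
    using Dirichlet_approx_simult[of N n "\<lambda>i. M * \<theta> i"] N_def by (metis add_gr_0 zero_less_one)
  have N: "1 / real N \<le> \<delta>"
  proof -
    have "1 / \<delta> \<le> real N" "real N > 0" unfolding N_def by linarith+
    then show ?thesis using \<delta> by (simp add: field_simps)
  qed
  have M: "real M \<ge> \<bar>T\<bar> + \<bar>t\<bar>" unfolding M_def by linarith
  \<comment> \<open>\<open>q * M\<close> is the almost-period; the factor \<open>M\<close> makes it at least \<open>T - t\<close>.\<close>
  define w where "w = t + of_int q * real M"
  have "real M * 1 \<le> real M * of_int q" using q by (intro mult_left_mono) auto
  then have wT: "w \<ge> T" using M by (simp add: w_def mult.commute)
  have "norm (of_nat p powr (- \<i> * of_real w) - \<psi> p) < \<epsilon>" if p: "p \<in> A" for p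
  proof -
    obtain i where i: "i < n" "p = g i" using g p by (auto simp: bij_betw_def n_def)
    define \<eta> where "\<eta> = w * \<theta> i - of_int (h i + k i) - \<alpha> i"
    have "\<bar>\<eta>\<bar> \<le> \<bar>t * \<theta> i - of_int (h i) - \<alpha> i\<bar> + \<bar>of_int q * (M * \<theta> i) - of_int (k i)\<bar>"
      unfolding \<eta>_def w_def by (simp add: algebra_simps)
    also have "\<dots> < \<delta> + \<delta>" using t[OF i(1)] k[OF i(1)] N by linarith
    finally have \<eta>: "\<bar>\<eta>\<bar> < 2 * \<delta>" by simp
    have "w * ln (real p) = 2 * pi * (w * \<theta> i)" by (simp add: \<theta>_def \<phi>_def i)
    also have "w * \<theta> i = \<eta> + of_int (h i + k i) + \<alpha> i" by (simp add: \<eta>_def)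
    finally have wp: "w * ln (real p) = 2 * pi * \<eta> + 2 * pi * of_int (h i + k i) - Arg (\<psi> p)"
      by (simp add: \<alpha>_def i algebra_simps)
    have "p > 0" using A p prime_gt_0_nat by blast
    then have "of_nat p powr (- \<i> * of_real w) = exp (- \<i> * of_real (w * ln (real p)))"
      by (simp add: of_nat_powr_eq_exp mult_ac)
    also have "- \<i> * of_real (w * ln (real p)) =
        \<i> * of_real (- 2 * pi * \<eta>) + \<i> * of_real (Arg (\<psi> p)) + \<i> * (of_int (- (h i + k i)) * (of_real pi * 2))"
      unfolding wp by (simp add: algebra_simps)
    also have "exp \<dots> = exp (\<i> * of_real (- 2 * pi * \<eta>)) * exp (\<i> * of_real (Arg (\<psi> p)))"
      by (simp only: exp_plus_2pin) (simp only: exp_add)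
    also have "exp (\<i> * of_real (Arg (\<psi> p))) = \<psi> p"
      using Arg_eq[of "\<psi> p"] \<psi>[OF p] by fastforce
    finally have "of_nat p powr (- \<i> * of_real w) - \<psi> p = (exp (\<i> * of_real (- 2 * pi * \<eta>)) - 1) * \<psi> p"
      by (simp add: algebra_simps)
    then have "norm (of_nat p powr (- \<i> * of_real w) - \<psi> p) = norm (exp (\<i> * of_real (- 2 * pi * \<eta>)) - 1)"
      using \<psi>[OF p] by (simp add: norm_mult)
    also have "\<dots> \<le> \<bar>- 2 * pi * \<eta>\<bar>" by (rule norm_exp_i_minus_1_le)
    also have "\<dots> < \<epsilon>" using \<eta> by (simp add: abs_mult \<delta>_def field_simps)
    finally show ?thesis .
  qed
  then show ?thesis using wT by blast
qed

text \<open>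
  At stage \<open>j\<close> the primes up to \<open>j\<close> are matched with accuracy \<open>1 / (j + 1)\<close> beyond height \<open>j\<close>; a fixed
  \<open>n\<close> involves only finitely many primes.
\<close>

lemma vertical_shifts_to_character:
  assumes \<psi>: "\<And>p. prime p \<Longrightarrow> norm (\<psi> p) = 1"
  shows "\<exists>\<tau>::nat \<Rightarrow> real. filterlim \<tau> at_top sequentially \<and>
    (\<forall>n\<ge>1. (\<lambda>j. of_nat n powr (- \<i> * of_real (\<tau> j))) \<longlonglongrightarrow> mult_ext \<psi> n)"
proof -
  define near where "near = (\<lambda>j t. t \<ge> real j \<and>
    (\<forall>p\<in>{p. prime p \<and> p \<le> j}. norm (of_nat p powr (- \<i> * of_real t) - \<psi> p) < 1 / real (Suc j)))"
  have "\<exists>t. near j t" for j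
  proof -
    have "\<exists>t\<ge>real j. \<forall>p\<in>{p. prime p \<and> p \<le> j}.
        norm (of_nat p powr (- \<i> * of_real t) - \<psi> p) < 1 / real (Suc j)"
      by (rule kronecker_primes) (use \<psi> in auto)
    then show ?thesis unfolding near_def by blast
  qed
  then obtain \<tau> where near: "\<And>j. near j (\<tau> j)"
    by metis
  have \<tau>: "\<tau> j \<ge> real j"
    "prime p \<Longrightarrow> p \<le> j \<Longrightarrow> norm (of_nat p powr (- \<i> * of_real (\<tau> j)) - \<psi> p) < 1 / real (Suc j)" for j p
    using near[of j] unfolding near_def by blast+
  have lp: "(\<lambda>j. of_nat p powr (- \<i> * of_real (\<tau> j))) \<longlonglongrightarrow> \<psi> p" if "prime p" for p
  proof (rule LIM_zero_cancel, rule Lim_null_comparison)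
    show "\<forall>\<^sub>F j in sequentially. norm (of_nat p powr (- \<i> * of_real (\<tau> j)) - \<psi> p) \<le> 1 / real (Suc j)"
      using eventually_ge_at_top[of p]
      by eventually_elim (rule less_imp_le[OF \<tau>(2)[OF that]])
    show "(\<lambda>j. 1 / real (Suc j)) \<longlonglongrightarrow> 0"
      using LIMSEQ_inverse_real_of_nat by (simp add: inverse_eq_divide)
  qed
  have "filterlim \<tau> at_top sequentially"
    using filterlim_at_top_mono[OF filterlim_real_sequentially] \<tau>(1) by simp
  moreover have "(\<lambda>j. of_nat n powr (- \<i> * of_real (\<tau> j))) \<longlonglongrightarrow> mult_ext \<psi> n" if "n \<ge> 1" for n
    using that lp
    by (subst of_nat_powr_eq_mult_ext) (auto simp: mult_ext_def in_prime_factors_iff intro!: tendsto_prod tendsto_power)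
  ultimately show ?thesis by blast
qed

section \<open>Zeros of a twist produce zeros of the series\<close>

lemma dirichlet_series_shift_tendsto:
  assumes conv: "dirichlet_abs_conv a s"
    and lim: "\<And>n. n \<ge> 1 \<Longrightarrow> (\<lambda>j. of_nat n powr (- \<i> * of_real (\<tau> j))) \<longlonglongrightarrow> mult_ext \<psi> n"
  shows "(\<lambda>j. dirichlet_series a (s + \<i> * of_real (\<tau> j))) \<longlonglongrightarrow>
           dirichlet_series (\<lambda>n. a n * mult_ext \<psi> n) s"
proof -
  have "(\<lambda>j. dirichlet_series (\<lambda>n. a n * of_nat n powr (- \<i> * of_real (\<tau> j))) s) \<longlonglongrightarrow>
           dirichlet_series (\<lambda>n. a n * mult_ext \<psi> n) s"
    by (rule dirichlet_series_twist_tendsto[OF conv _ lim]) (simp_all add: norm_powr_real_powr)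
  then show ?thesis by (simp add: dirichlet_series_shift)
qed

text \<open>
  The identity between a series and the exponential of another one holds along all vertical shifts,
  hence also for their limits.
\<close>

lemma twisted_dirichlet_series_eq_exp:
  assumes \<psi>: "\<And>p. prime p \<Longrightarrow> norm (\<psi> p) = 1"
    and a: "\<And>s. Re s > 1 \<Longrightarrow> dirichlet_abs_conv a s"
    and \<beta>: "\<And>s. Re s > 1 \<Longrightarrow> dirichlet_abs_conv \<beta> s"
    and eq: "\<And>s. Re s > 1 \<Longrightarrow> dirichlet_series a s = exp (dirichlet_series \<beta> s)"
    and s: "Re s > 1"
  shows "dirichlet_series (\<lambda>n. a n * mult_ext \<psi> n) s = exp (dirichlet_series (\<lambda>n. \<beta> n * mult_ext \<psi> n) s)"
proof -
  obtain \<tau> where "filterlim \<tau> at_top sequentially" and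
      \<tau>: "\<And>n. n \<ge> 1 \<Longrightarrow> (\<lambda>j. of_nat n powr (- \<i> * of_real (\<tau> j))) \<longlonglongrightarrow> mult_ext \<psi> n"
    using vertical_shifts_to_character[of \<psi>, OF \<psi>] by blast
  have "(\<lambda>j. dirichlet_series a (s + \<i> * of_real (\<tau> j))) \<longlonglongrightarrow> dirichlet_series (\<lambda>n. a n * mult_ext \<psi> n) s"
    by (rule dirichlet_series_shift_tendsto[OF a[OF s] \<tau>])
  moreover have "(\<lambda>j. exp (dirichlet_series \<beta> (s + \<i> * of_real (\<tau> j)))) \<longlonglongrightarrow>
      exp (dirichlet_series (\<lambda>n. \<beta> n * mult_ext \<psi> n) s)"
    by (intro tendsto_exp dirichlet_series_shift_tendsto[OF \<beta>[OF s] \<tau>])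
  moreover have "exp (dirichlet_series \<beta> (s + \<i> * of_real (\<tau> j))) = dirichlet_series a (s + \<i> * of_real (\<tau> j))" for j
    using s by (subst eq) auto
  ultimately show ?thesis
    using LIMSEQ_unique by simp
qed

text \<open>
  If the untwisted series had only finitely many zeros, its shifts by \<open>\<tau>\<^sub>j\<close> would eventually be
  free of zeros in a small disc around \<open>s0\<close>. Hurwitz's theorem then forces the limit, which vanishes
  at \<open>s0\<close>, to be constant there; by analytic continuation and uniqueness of coefficients it is the
  zero series, against the assumption on \<open>u m\<close>.
\<close>

lemma infinite_zeros_of_twisted_zero:
  assumes \<psi>: "\<And>p. prime p \<Longrightarrow> norm (\<psi> p) = 1"
    and u: "\<And>s. Re s > 1 \<Longrightarrow> dirichlet_abs_conv u s"
    and nz: "m \<ge> 1" "u m \<noteq> 0"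
    and s0: "Re s0 > 1" and zero: "dirichlet_series (\<lambda>n. u n * mult_ext \<psi> n) s0 = 0"
  shows "infinite {s. Re s > 1 \<and> dirichlet_series u s = 0}"
proof
  assume fin: "finite {s. Re s > 1 \<and> dirichlet_series u s = 0}"
  define g where "g = dirichlet_series (\<lambda>n. u n * mult_ext \<psi> n)"
  have uc: "dirichlet_abs_conv (\<lambda>n. u n * mult_ext \<psi> n) s" if "Re s > 1" for s
    by (rule dirichlet_abs_conv_dominated[OF u[OF that]]) (auto simp: norm_mult norm_mult_ext[of \<psi>, OF \<psi>])
  have holg: "g holomorphic_on {s. Re s > 1}"
    unfolding g_def by (rule dirichlet_series_holomorphic) (rule uc)
  obtain T where T: "\<And>s. Re s > 1 \<Longrightarrow> dirichlet_series u s = 0 \<Longrightarrow> Im s \<le> T"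
  proof
    show "Im s \<le> Max (Im ` {s. Re s > 1 \<and> dirichlet_series u s = 0})"
      if "Re s > 1" "dirichlet_series u s = 0" for s
      by (rule Max_ge) (use fin that in auto)
  qed
  define r where "r = (Re s0 - 1) / 2"
  have r: "r > 0" using s0 by (simp add: r_def)
  have ball: "Re s \<ge> Re (of_real (1 + r) :: complex)" "\<bar>Im s - Im s0\<bar> \<le> r" if "s \<in> ball s0 r" for s
  proof -
    have "norm (s0 - s) < r" using that by (simp add: dist_norm)
    then have "\<bar>Re s0 - Re s\<bar> < r" "\<bar>Im s0 - Im s\<bar> < r"
      using abs_Re_le_cmod[of "s0 - s"] abs_Im_le_cmod[of "s0 - s"] by auto
    moreover have "Re s0 = 1 + 2 * r" by (simp add: r_def field_simps)
    ultimately show "Re s \<ge> Re (of_real (1 + r) :: complex)" "\<bar>Im s - Im s0\<bar> \<le> r" by auto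
  qed
  have H: "ball s0 r \<subseteq> {s. Re s > 1}"
    using ball(1) r by force
  have nonconst: "\<not> g constant_on ball s0 r"
  proof
    assume "g constant_on ball s0 r"
    then have g0: "g s = 0" if "s \<in> ball s0 r" for s
      using that zero r unfolding constant_on_def g_def by (metis centre_in_ball)
    have gz: "g s = 0" if "Re s > 1" for s
    proof (rule analytic_continuation[OF holg])
      show "open {s. Re s > 1}" by (rule open_halfspace_Re_gt)
      show "connected {s. Re s > 1}" by (intro convex_connected convex_halfspace_Re_gt)
      show "s0 islimpt ball s0 r" using r by (simp add: islimpt_ball)
    qed (use s0 H g0 that in auto)
    have "u m * mult_ext \<psi> m = 0"
      by (rule dirichlet_series_eq_0_imp_coeff_0[where \<sigma> = 2]) (use uc gz nz in \<open>auto simp: g_def\<close>)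
    then show False using nz norm_mult_ext[of \<psi> m, OF \<psi>] by auto
  qed
  obtain \<tau> :: "nat \<Rightarrow> real" where \<tau>: "filterlim \<tau> at_top sequentially"
    "\<And>n. n \<ge> 1 \<Longrightarrow> (\<lambda>j. of_nat n powr (- \<i> * of_real (\<tau> j))) \<longlonglongrightarrow> mult_ext \<psi> n"
    using vertical_shifts_to_character[of \<psi>, OF \<psi>] by blast
  \<comment> \<open>Beyond \<open>j0\<close> the whole shifted disc lies above all zeros.\<close>
  obtain j0 where j0: "\<And>j. j \<ge> j0 \<Longrightarrow> \<tau> j > T - Im s0 + r"
    using \<tau>(1) unfolding filterlim_at_top_dense eventually_sequentially by metis
  define F where "F = (\<lambda>j s. dirichlet_series u (s + \<i> * of_real (\<tau> (j + j0))))"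
  have "g s0 \<noteq> 0"
  proof (rule Hurwitz_no_zeros[where S = "ball s0 r" and \<F> = F and g = g and ?z0.0 = s0])
    show "F j holomorphic_on ball s0 r" for j
    proof -
      have "dirichlet_series u \<circ> (\<lambda>s. s + \<i> * of_real (\<tau> (j + j0))) holomorphic_on ball s0 r"
        using H by (intro holomorphic_on_compose_gen[OF _ dirichlet_series_holomorphic[of 1 u]] u)
          (auto intro!: holomorphic_intros)
      then show ?thesis by (simp add: F_def o_def)
    qed
    show "g holomorphic_on ball s0 r" using holg H by (rule holomorphic_on_subset)
    show "uniform_limit K F g sequentially" if "compact K" "K \<subseteq> ball s0 r" for K
    proof -
      have "uniform_limit {s. Re s \<ge> Re (of_real (1 + r) :: complex)}
         (\<lambda>j. dirichlet_series (\<lambda>n. u n * of_nat n powr (- \<i> * of_real (\<tau> (j + j0))))) g sequentially"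
        unfolding g_def
        by (rule dirichlet_series_twist_uniform_limit[OF u])
           (use r \<tau>(2) in \<open>auto simp: norm_powr_real_powr intro!: LIMSEQ_ignore_initial_segment\<close>)
      then show ?thesis
        by (rule uniform_limit_on_subset[THEN uniform_limit_cong'[THEN iffD1, rotated -1]])
           (use that ball(1) in \<open>auto simp: F_def dirichlet_series_shift\<close>)
    qed
    show "F j s \<noteq> 0" if "s \<in> ball s0 r" for j s
      using T[of "s + \<i> * of_real (\<tau> (j + j0))"] j0[of "j + j0"] ball[OF that] r by (auto simp: F_def)
  qed (use nonconst r in auto)
  then show False using zero by (simp add: g_def)
qed

section \<open>Prescribing a sum by continuous choice of phases\<close>

text \<open>
  Greedy choice: the next element always joins the part with the smaller sum.
\<close>

lemma balanced_partition:
  fixes r :: "'a \<Rightarrow> real"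
  assumes "finite A" "\<And>x. x \<in> A \<Longrightarrow> 0 \<le> r x" "\<And>x. x \<in> A \<Longrightarrow> r x \<le> M" "M \<ge> 0"
  shows "\<exists>B\<subseteq>A. \<bar>sum r B - sum r (A - B)\<bar> \<le> M"
  using assms
proof (induction A rule: finite_induct)
  case empty
  then show ?case by auto
next
  case (insert x A)
  then obtain B where B: "B \<subseteq> A" "\<bar>sum r B - sum r (A - B)\<bar> \<le> M" by auto
  have rx: "0 \<le> r x" "r x \<le> M" using insert.prems by auto
  have fin: "finite B" "finite (A - B)" "x \<notin> B" "x \<notin> A - B"
    using insert.hyps B(1) finite_subset by auto
  show ?case
  proof (cases "sum r B \<le> sum r (A - B)")
    case True
    have "insert x A - insert x B = A - B" using insert.hyps by auto
    then have "\<bar>sum r (insert x B) - sum r (insert x A - insert x B)\<bar> \<le> M"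
      using True B(2) rx fin by (simp add: abs_le_iff)
    then show ?thesis using B(1) by (intro exI[of _ "insert x B"]) auto
  next
    case False
    have "insert x A - B = insert x (A - B)" using fin by auto
    then have "\<bar>sum r B - sum r (insert x A - B)\<bar> \<le> M"
      using False B(2) rx fin by (simp add: abs_le_iff)
    then show ?thesis using B(1) by (intro exI[of _ B]) auto
  qed
qed

text \<open>
  The index set is split into two parts of nearly equal sum; one part gets the phase \<open>c + \<i> * d\<close> and
  the other its conjugate, with \<open>c = X w / sum r A\<close>. The real part of the result is exactly \<open>X w\<close>,
  and the imaginary part is at most the imbalance \<open>M\<close>.
\<close>

lemma steer_real:
  fixes r :: "'a \<Rightarrow> real" and X :: "'b::topological_space \<Rightarrow> real"
  assumes A: "finite A" "\<And>x. x \<in> A \<Longrightarrow> 0 \<le> r x" "\<And>x. x \<in> A \<Longrightarrow> r x \<le> M" "M \<ge> 0"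
    and R: "R > 0" "sum r A \<ge> R"
    and X: "continuous_on W X" "\<And>w. w \<in> W \<Longrightarrow> \<bar>X w\<bar> \<le> R"
  shows "\<exists>e::'a \<Rightarrow> 'b \<Rightarrow> complex. (\<forall>p. continuous_on W (e p)) \<and> (\<forall>p. \<forall>w\<in>W. norm (e p w) = 1) \<and>
             (\<forall>w\<in>W. norm ((\<Sum>p\<in>A. of_real (r p) * e p w) - of_real (X w)) \<le> M)"
proof -
  obtain B where B: "B \<subseteq> A" "\<bar>sum r B - sum r (A - B)\<bar> \<le> M"
    using balanced_partition[of A r M, OF A] by auto
  define c where "c = (\<lambda>w. X w / sum r A)"
  define d where "d = (\<lambda>w. sqrt (1 - (c w)\<^sup>2))"
  define e where "e = (\<lambda>p w. if p \<in> B then Complex (c w) (d w) else Complex (c w) (- d w))"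
  have c: "\<bar>c w\<bar> \<le> 1" if "w \<in> W" for w
    using X(2)[OF that] R by (simp add: c_def abs_divide divide_simps)
  have c2: "(c w)\<^sup>2 \<le> 1" if "w \<in> W" for w
    using c[OF that] by (simp add: abs_square_le_1)
  have d: "\<bar>d w\<bar> \<le> 1" if "w \<in> W" for w
    using c2[OF that] by (simp add: d_def)
  have cont: "continuous_on W c" "continuous_on W d"
    unfolding d_def c_def using R by (auto intro!: continuous_intros X(1))
  have sum: "(\<Sum>p\<in>A. of_real (r p) * e p w) = of_real (X w) + \<i> * of_real ((sum r B - sum r (A - B)) * d w)" for w
  proof -
    have "(\<Sum>p\<in>A. of_real (r p) * e p w) = (\<Sum>p\<in>B. of_real (r p) * e p w) + (\<Sum>p\<in>A - B. of_real (r p) * e p w)"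
      using A(1) B(1) by (simp add: sum.subset_diff add.commute)
    also have "(\<Sum>p\<in>B. of_real (r p) * e p w) = of_real (sum r B) * Complex (c w) (d w)"
      by (simp add: e_def sum_distrib_right)
    also have "(\<Sum>p\<in>A - B. of_real (r p) * e p w) = of_real (sum r (A - B)) * Complex (c w) (- d w)"
      by (simp add: e_def sum_distrib_right)
    also have "of_real (sum r B) * Complex (c w) (d w) + of_real (sum r (A - B)) * Complex (c w) (- d w)
       = Complex ((sum r B + sum r (A - B)) * c w) ((sum r B - sum r (A - B)) * d w)"
      by (simp add: complex_eq_iff algebra_simps)
    also have "sum r B + sum r (A - B) = sum r A"
      using A(1) B(1) by (simp add: sum.subset_diff add.commute)
    also have "sum r A * c w = X w" using R by (simp add: c_def)
    finally show ?thesis by (simp add: complex_eq_iff)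
  qed
  show ?thesis
  proof (intro exI[of _ e] conjI allI ballI)
    show "continuous_on W (e p)" for p
      by (cases "p \<in> B") (auto simp: e_def Complex_eq intro!: continuous_intros cont)
    show "norm (e p w) = 1" if "w \<in> W" for p w
      using c2[OF that] by (simp add: e_def cmod_def d_def)
    show "norm ((\<Sum>p\<in>A. of_real (r p) * e p w) - of_real (X w)) \<le> M" if "w \<in> W" for w
    proof -
      have "\<bar>(sum r B - sum r (A - B)) * d w\<bar> \<le> M * 1"
        unfolding abs_mult using B(2) d[OF that] A(4) by (intro mult_mono) auto
      then show ?thesis unfolding sum by (simp add: norm_mult del: of_real_mult of_real_diff of_real_sum)
    qed
  qed
qed

text \<open>
  Two groups of phases are used, one steered to the real part and the other, rotated by \<open>\<i>\<close>, to the
  imaginary part. The obvious choice of two phases whose bisector points towards \<open>w\<close> would be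
  discontinuous at \<open>w = 0\<close>.
\<close>

lemma steer_complex:
  fixes r :: "'a \<Rightarrow> real"
  assumes A: "finite A" "\<And>x. x \<in> A \<Longrightarrow> 0 \<le> r x" "\<And>x. x \<in> A \<Longrightarrow> r x \<le> M" "M \<ge> 0"
    and R: "R > 0" "sum r A \<ge> 2 * R + M"
  shows "\<exists>e::'a \<Rightarrow> complex \<Rightarrow> complex. (\<forall>p. continuous_on (cball 0 R) (e p)) \<and> (\<forall>p. \<forall>w\<in>cball 0 R. norm (e p w) = 1) \<and>
             (\<forall>w\<in>cball 0 R. norm ((\<Sum>p\<in>A. of_real (r p) * e p w) - w) \<le> 2 * M)"
proof -
  let ?W = "cball (0::complex) R"
  obtain B where B: "B \<subseteq> A" "\<bar>sum r B - sum r (A - B)\<bar> \<le> M"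
    using balanced_partition[of A r M, OF A] by auto
  have split: "sum h A = sum h B + sum h (A - B)" for h :: "'a \<Rightarrow> complex"
    using A(1) B(1) by (metis add.commute sum.subset_diff)
  have "sum r A = sum r B + sum r (A - B)"
    using A(1) B(1) by (metis add.commute sum.subset_diff)
  then have "sum r B \<ge> R" "sum r (A - B) \<ge> R"
    using B(2) R by linarith+
  have "\<exists>e::'a \<Rightarrow> complex \<Rightarrow> complex. (\<forall>p. continuous_on ?W (e p)) \<and> (\<forall>p. \<forall>w\<in>?W. norm (e p w) = 1) \<and>
             (\<forall>w\<in>?W. norm ((\<Sum>p\<in>B. of_real (r p) * e p w) - of_real (Re w)) \<le> M)"
    using A B(1) finite_subset[OF B(1)] \<open>sum r B \<ge> R\<close> R(1) abs_Re_le_cmod order_trans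
    by (intro steer_real[where R = R]) (auto intro!: continuous_intros, blast+)
  then obtain e :: "'a \<Rightarrow> complex \<Rightarrow> complex" where e: "\<And>p. continuous_on ?W (e p)" "\<And>p w. w \<in> ?W \<Longrightarrow> norm (e p w) = 1"
     "\<And>w. w \<in> ?W \<Longrightarrow> norm ((\<Sum>p\<in>B. of_real (r p) * e p w) - of_real (Re w)) \<le> M"
    by blast
  have "\<exists>e::'a \<Rightarrow> complex \<Rightarrow> complex. (\<forall>p. continuous_on ?W (e p)) \<and> (\<forall>p. \<forall>w\<in>?W. norm (e p w) = 1) \<and>
             (\<forall>w\<in>?W. norm ((\<Sum>p\<in>A - B. of_real (r p) * e p w) - of_real (Im w)) \<le> M)"
    using A \<open>sum r (A - B) \<ge> R\<close> R(1) abs_Im_le_cmod order_trans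
    by (intro steer_real[where R = R]) (auto intro!: continuous_intros, blast+)
  then obtain f :: "'a \<Rightarrow> complex \<Rightarrow> complex" where f: "\<And>p. continuous_on ?W (f p)" "\<And>p w. w \<in> ?W \<Longrightarrow> norm (f p w) = 1"
     "\<And>w. w \<in> ?W \<Longrightarrow> norm ((\<Sum>p\<in>A - B. of_real (r p) * f p w) - of_real (Im w)) \<le> M"
    by blast
  define g where "g = (\<lambda>p w. if p \<in> B then e p w else \<i> * f p w)"
  show ?thesis
  proof (intro exI[of _ g] conjI allI ballI)
    show "continuous_on ?W (g p)" for p
      by (cases "p \<in> B") (auto simp: g_def intro!: continuous_intros e f)
    show "norm (g p w) = 1" if "w \<in> ?W" for p w
      using e(2)[OF that] f(2)[OF that] by (simp add: g_def norm_mult)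
    show "norm ((\<Sum>p\<in>A. of_real (r p) * g p w) - w) \<le> 2 * M" if "w \<in> ?W" for w
    proof -
      have "(\<Sum>p\<in>B. of_real (r p) * g p w) = (\<Sum>p\<in>B. of_real (r p) * e p w)"
        by (intro sum.cong) (auto simp: g_def)
      moreover have "(\<Sum>p\<in>A - B. of_real (r p) * g p w) = \<i> * (\<Sum>p\<in>A - B. of_real (r p) * f p w)"
        unfolding sum_distrib_left by (intro sum.cong) (auto simp: g_def)
      ultimately have "(\<Sum>p\<in>A. of_real (r p) * g p w) - w =
          ((\<Sum>p\<in>B. of_real (r p) * e p w) - of_real (Re w)) +
          \<i> * ((\<Sum>p\<in>A - B. of_real (r p) * f p w) - of_real (Im w))"
        unfolding split using complex_eq[of w] by (simp add: algebra_simps)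
      also have "norm \<dots> \<le> M + M"
        using e(3)[OF that] f(3)[OF that] by (intro norm_triangle_le add_mono) (simp_all add: norm_mult)
      finally show ?thesis by simp
    qed
  qed
qed

section \<open>A zero of a twisted sum\<close>

text \<open>
  Continuity along sequences is the dominated convergence statement above, as each value of the
  multiplicative extension is a finite product of continuous functions.
\<close>

lemma twisted_series_continuous:
  fixes \<psi> :: "'a::metric_space \<Rightarrow> nat \<Rightarrow> complex"
  assumes conv: "dirichlet_abs_conv a s"
    and cont: "\<And>p. continuous_on W (\<lambda>w. \<psi> w p)"
    and unit: "\<And>p w. w \<in> W \<Longrightarrow> prime p \<Longrightarrow> norm (\<psi> w p) = 1"
  shows "continuous_on W (\<lambda>w. dirichlet_series (\<lambda>n. a n * mult_ext (\<psi> w) n) s)"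
  unfolding continuous_on_sequentially
proof (intro allI ballI impI; elim conjE)
  fix x :: "nat \<Rightarrow> 'a" and w
  assume w: "w \<in> W" and x: "\<forall>j. x j \<in> W" "x \<longlonglongrightarrow> w"
  have lim: "(\<lambda>j. mult_ext (\<psi> (x j)) n) \<longlonglongrightarrow> mult_ext (\<psi> w) n" for n
    unfolding mult_ext_def using x w
    by (intro tendsto_prod tendsto_power continuous_on_tendsto_compose[OF cont]) auto
  have bd: "norm (mult_ext (\<psi> (x j)) n) \<le> 1" for j n
    using norm_mult_ext[of "\<psi> (x j)" n] unit x by auto
  have "(\<lambda>j. dirichlet_series (\<lambda>n. a n * mult_ext (\<psi> (x j)) n) s) \<longlonglongrightarrow>
          dirichlet_series (\<lambda>n. a n * mult_ext (\<psi> w) n) s"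
    by (rule dirichlet_series_twist_tendsto[OF conv bd lim])
  then show "((\<lambda>w. dirichlet_series (\<lambda>n. a n * mult_ext (\<psi> w) n) s) \<circ> x) \<longlonglongrightarrow>
          dirichlet_series (\<lambda>n. a n * mult_ext (\<psi> w) n) s"
    by (simp add: o_def)
qed

lemma norm_Ln_le:
  assumes "z \<noteq> 0"
  shows "norm (Ln z) \<le> \<bar>ln (norm z)\<bar> + pi"
proof -
  have "norm (Ln z) \<le> \<bar>Re (Ln z)\<bar> + \<bar>Im (Ln z)\<bar>" by (rule cmod_le)
  moreover have "\<bar>Im (Ln z)\<bar> \<le> pi"
    using mpi_less_Im_Ln[OF assms] Im_Ln_le_pi[OF assms] by linarith
  ultimately show ?thesis using assms by simp
qed

text \<open>
  The map \<open>w \<mapsto> w - T w + y w\<close> sends a large disc to itself, where \<open>T w\<close> is the twisted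
  logarithm, within a bounded distance of \<open>w\<close>, and \<open>y w\<close> is a bounded continuous logarithm of minus
  the twisted \<open>f\<close>. At a fixed point \<open>T w = y w\<close>.
  
  All constants entering the radius \<open>R\<close> are independent of \<open>\<sigma>\<close>, so \<open>\<sigma>\<close> can be chosen after \<open>R\<close>:
  \<open>C1\<close> bounds the contribution of the numbers that are not prime, \<open>C2\<close> that of the primes up to \<open>P\<close>,
  1 that of the primes outside a finite set carrying almost the whole sum,
  \<open>2 * K\<close> is the error of steering and \<open>B + 2 * pi + 1\<close> bounds \<open>y\<close>.
\<close>

lemma twisted_sum_has_zero:
  fixes \<beta> c :: "nat \<Rightarrow> complex"
  assumes c: "dirichlet_abs_conv c 1"
    and f: "\<And>x. x \<ge> 1 \<Longrightarrow> exp (- B) \<le> norm (dirichlet_series c (of_real x))"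
           "\<And>x. x \<ge> 1 \<Longrightarrow> norm (dirichlet_series c (of_real x)) \<le> exp B"
    and \<beta>: "\<And>s. Re s > 1 \<Longrightarrow> dirichlet_abs_conv \<beta> s"
    and nonprime: "(\<lambda>n. norm (\<beta> n) * real n powr (- 1)) summable_on {n. n \<ge> 1 \<and> \<not> prime n}"
    and bound: "\<And>p. prime p \<Longrightarrow> norm (\<beta> p) \<le> K * real p"
    and unbounded: "\<And>Q. \<exists>\<sigma>>1. Q \<le> infsum (\<lambda>p. norm (\<beta> p) * real p powr (- \<sigma>)) {p. prime p}"
  shows "\<exists>\<psi> \<sigma>. (\<forall>p. prime p \<longrightarrow> norm (\<psi> p) = 1) \<and> \<sigma> > 1 \<and>
     exp (dirichlet_series (\<lambda>n. \<beta> n * mult_ext \<psi> n) (of_real \<sigma>)) +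
     dirichlet_series (\<lambda>n. c n * mult_ext \<psi> n) (of_real \<sigma>) = 0"
proof -
  have B0: "B \<ge> 0"
    using order_trans[OF f(1)[of 1] f(2)[of 1]] by simp
  have K0: "K \<ge> 0"
    using order_trans[OF norm_ge_zero bound[of 2]] by simp
  define C1 where "C1 = infsum (\<lambda>n. norm (\<beta> n) * real n powr (- 1)) {n. n \<ge> 1 \<and> \<not> prime n}"
  have C1: "C1 \<ge> 0" unfolding C1_def by (rule infsum_nonneg) simp
  define q where "q = (\<lambda>n. norm (c n) * real n powr (- 1))"
  have q: "q summable_on {1..}" "\<And>n. q n \<ge> 0"
    using c by (auto simp: dirichlet_abs_conv_iff q_def)
  obtain F where F: "finite F" "F \<subseteq> {1..}" "\<bar>infsum q {1..} - sum q F\<bar> \<le> exp (- B) / 4"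
    using infsum_finite_approximation[OF q(1), of "exp (- B) / 4"] by (auto simp: dist_real_def abs_minus_commute)
  \<comment> \<open>Numbers up to \<open>P\<close> will keep the twist 1; the coefficients of \<open>c\<close> beyond carry at most a quarter of the lower bound of \<open>f\<close>.\<close>
  obtain P where P: "F \<subseteq> {..P}"
    using F(1) finite_nat_set_iff_bounded_le[of F] by (auto simp: subset_iff)
  have tail: "infsum q {P<..} \<le> exp (- B) / 4"
  proof -
    have "infsum q {P<..} \<le> infsum q ({1..} - F)"
      using P by (intro infsum_mono_neutral summable_on_subset[OF q(1)]) (use q(2) in auto)
    also have "\<dots> = infsum q {1..} - sum q F"
      using infsum_Diff[OF q(1) _ F(2)] F(1) by simp
    finally show ?thesis using F(3) by linarith
  qed
  define C2 where "C2 = (\<Sum>n\<le>P. norm (\<beta> n))"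
  have C2: "C2 \<ge> 0" unfolding C2_def by (rule sum_nonneg) simp
  define R where "R = 2 * K + (C1 + C2 + 1) + (B + 2 * pi + 1)"
  have R: "R > 0" using K0 C1 C2 B0 by (simp add: R_def add_nonneg_pos)
  obtain \<sigma> where \<sigma>: "\<sigma> > 1"
    and big: "2 * R + K + C2 + 1 \<le> infsum (\<lambda>p. norm (\<beta> p) * real p powr (- \<sigma>)) {p. prime p}"
    using unbounded by blast
  define r where "r = (\<lambda>n. norm (\<beta> n) * real n powr (- \<sigma>))"
  have r: "r summable_on {1..}" "\<And>n. r n \<ge> 0"
    using \<beta>[of "of_real \<sigma>"] \<sigma> by (auto simp: dirichlet_abs_conv_iff r_def)
  have pr: "{p::nat. prime p} \<subseteq> {1..}" using prime_ge_1_nat by auto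
  have rp: "r summable_on {p. prime p}" by (rule summable_on_subset[OF r(1) pr])
  define S where "S = infsum r {p. prime p}"
  obtain F' where F': "finite F'" "F' \<subseteq> {p. prime p}" "\<bar>S - sum r F'\<bar> \<le> 1"
    using infsum_finite_approximation[OF rp, of 1] by (auto simp: dist_real_def abs_minus_commute S_def)
  define A where "A = {p\<in>F'. p > P}"
  have A: "finite A" "\<And>p. p \<in> A \<Longrightarrow> prime p" "\<And>p. p \<in> A \<Longrightarrow> p > P" "A \<subseteq> {p. prime p}"
    using F' by (auto simp: A_def)
  have r_le: "r n \<le> norm (\<beta> n) * real n powr (- 1)" if "n \<ge> 1" for n
    unfolding r_def using that \<sigma> by (intro mult_left_mono powr_mono) auto
  have sumA: "sum r A \<ge> S - 1 - C2"
  proof -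
    have "sum r F' = sum r A + sum r (F' - A)"
      using F'(1) sum.subset_diff[of A F' r] by (auto simp: A_def)
    moreover have "sum r (F' - A) \<le> (\<Sum>n\<in>F' - A. norm (\<beta> n))"
    proof (rule sum_mono)
      fix n assume "n \<in> F' - A"
      then have "n \<ge> 1" using F'(2) pr by auto
      then have "real n powr (- \<sigma>) \<le> real n powr 0" using \<sigma> by (intro powr_mono) auto
      then show "r n \<le> norm (\<beta> n)" using \<open>n \<ge> 1\<close> unfolding r_def by (intro mult_left_le) auto
    qed
    moreover have "(\<Sum>n\<in>F' - A. norm (\<beta> n)) \<le> C2"
      unfolding C2_def by (rule sum_mono2) (auto simp: A_def)
    ultimately show ?thesis using F'(3) by linarith
  qed
  have rest: "infsum r ({1..} - A) \<le> C1 + C2 + 1"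
  proof -
    have "{1..} - A = {n. n \<ge> 1 \<and> \<not> prime n} \<union> ({p. prime p} - A)" using pr A(2) by auto
    then have "infsum r ({1..} - A) = infsum r {n. n \<ge> 1 \<and> \<not> prime n} + infsum r ({p. prime p} - A)"
      by (simp only:) (rule infsum_Un_disjoint, auto intro!: summable_on_subset[OF r(1)] simp: prime_ge_1_nat)
    moreover have "infsum r {n. n \<ge> 1 \<and> \<not> prime n} \<le> C1"
      unfolding C1_def by (intro infsum_mono nonprime summable_on_subset[OF r(1)] r_le) auto
    moreover have "infsum r ({p. prime p} - A) = S - sum r A"
      unfolding S_def using infsum_Diff[OF rp _ A(4)] A(1) by simp
    ultimately show ?thesis using sumA by linarith
  qed
  have rK: "r p \<le> K" if "p \<in> A" for p
  proof -
    have p: "prime p" "real p > 0" using A(2)[OF that] prime_gt_0_nat by auto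
    then have "r p \<le> K * real p * real p powr (- 1)"
      using order_trans[OF r_le mult_right_mono[OF bound]] prime_ge_1_nat[OF p(1)] by auto
    also have "\<dots> = K" using p(2) by (simp add: powr_minus)
    finally show ?thesis .
  qed
  have "sum r A \<ge> 2 * R + K" using sumA big by (simp add: S_def r_def)
  then obtain e where e: "\<And>p. continuous_on (cball 0 R) (e p)"
      "\<And>p w. w \<in> cball 0 R \<Longrightarrow> norm (e p w :: complex) = 1"
      "\<And>w. w \<in> cball 0 R \<Longrightarrow> norm ((\<Sum>p\<in>A. of_real (r p) * e p w) - w) \<le> 2 * K"
    using steer_complex[of A r K R] A(1) r(2) rK K0 R by blast
  \<comment> \<open>\<open>v p\<close> rotates \<open>\<beta> p\<close> to the positive real axis; where \<open>\<beta> p = 0\<close> any unimodular value will do.\<close>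
  define v where "v = (\<lambda>p. if \<beta> p = 0 then 1 else cnj (sgn (\<beta> p)))"
  have v: "norm (v p) = 1" "\<beta> p * v p = of_real (norm (\<beta> p))" for p
  proof -
    show "norm (v p) = 1" by (simp add: v_def norm_sgn)
    have "\<beta> p * cnj (\<beta> p) = of_real (norm (\<beta> p)) * of_real (norm (\<beta> p))"
      using complex_norm_square[of "\<beta> p"] by (simp add: power2_eq_square)
    then show "\<beta> p * v p = of_real (norm (\<beta> p))"
      by (simp add: v_def sgn_eq)
  qed
  define \<psi> where "\<psi> = (\<lambda>w p. if p \<in> A then v p * e p w else 1)"
  have unit: "norm (\<psi> w p) = 1" if "w \<in> cball 0 R" for w p
    using e(2)[OF that] v(1) by (simp add: \<psi>_def norm_mult)
  have cont: "continuous_on (cball 0 R) (\<lambda>w. \<psi> w p)" for p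
    by (cases "p \<in> A") (auto simp: \<psi>_def intro!: continuous_intros e(1))
  have nm: "norm (mult_ext (\<psi> w) n) = 1" if "w \<in> cball 0 R" for w n
    by (rule norm_mult_ext) (rule unit[OF that])
  define T where "T = (\<lambda>w. dirichlet_series (\<lambda>n. \<beta> n * mult_ext (\<psi> w) n) (of_real \<sigma>))"
  define h where "h = (\<lambda>w. dirichlet_series (\<lambda>n. c n * mult_ext (\<psi> w) n) (of_real \<sigma>))"
  have c\<sigma>: "dirichlet_abs_conv c (of_real \<sigma>)"
    by (rule dirichlet_abs_conv_dominated[OF c]) (use \<sigma> in auto)
  have \<beta>\<sigma>: "dirichlet_abs_conv \<beta> (of_real \<sigma>)" using \<sigma> by (intro \<beta>) simp
  have contT: "continuous_on (cball 0 R) T" and conth: "continuous_on (cball 0 R) h"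
    unfolding T_def h_def by (intro twisted_series_continuous c\<sigma> \<beta>\<sigma> cont unit; assumption)+
  have T: "norm ((\<Sum>p\<in>A. of_real (r p) * e p w) - T w) \<le> C1 + C2 + 1" if w: "w \<in> cball 0 R" for w
  proof -
    define d where "d = dirichlet_term (\<lambda>n. \<beta> n * mult_ext (\<psi> w) n) (of_real \<sigma>)"
    have "dirichlet_abs_conv (\<lambda>n. \<beta> n * mult_ext (\<psi> w) n) (of_real \<sigma>)"
      by (rule dirichlet_abs_conv_dominated[OF \<beta>\<sigma>]) (auto simp: norm_mult nm[OF w])
    then have "(d has_sum T w) {1..}"
      unfolding d_def T_def by (rule dirichlet_series_has_sum)
    then have "(d has_sum T w - sum d A) ({1..} - A)"
      using A pr by (intro has_sum_Diff has_sum_finite) auto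
    moreover have "(r has_sum infsum r ({1..} - A)) ({1..} - A)"
      by (intro has_sum_infsum summable_on_subset[OF r(1)]) auto
    moreover have "norm (d n) \<le> r n" if "n \<in> {1..} - A" for n
      using that by (simp add: d_def r_def norm_dirichlet_term norm_mult nm[OF w])
    ultimately have "norm (T w - sum d A) \<le> infsum r ({1..} - A)"
      by (rule norm_infsum_le)
    moreover have "sum d A = (\<Sum>p\<in>A. of_real (r p) * e p w)"
    proof (rule sum.cong[OF refl])
      fix p assume p: "p \<in> A"
      then have "p > 0" using A(2) prime_gt_0_nat by auto
      then have pw: "of_nat p powr complex_of_real \<sigma> = of_real (real p powr \<sigma>)"
        by (simp add: of_nat_powr_eq_exp powr_def exp_of_real flip: of_real_mult)
      have "d p = (\<beta> p * v p) * e p w / of_real (real p powr \<sigma>)"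
        using p A(2) by (simp add: d_def dirichlet_term_def mult_ext_prime \<psi>_def pw mult_ac)
      then show "d p = of_real (r p) * e p w"
        by (simp add: v(2) r_def powr_minus field_simps)
    qed
    ultimately show ?thesis using rest by (simp add: norm_minus_commute)
  qed
  define f0 where "f0 = dirichlet_series c (of_real \<sigma>)"
  have f0: "exp (- B) \<le> norm f0" "norm f0 \<le> exp B"
    using f[of \<sigma>] \<sigma> by (auto simp: f0_def)
  have f0nz: "f0 \<noteq> 0" using f0(1) by (metis exp_gt_zero norm_zero not_less)
  have h: "norm (h w - f0) \<le> exp (- B) / 2" if w: "w \<in> cball 0 R" for w
  proof -
    define d where "d = (\<lambda>n. dirichlet_term (\<lambda>n. c n * mult_ext (\<psi> w) n) (of_real \<sigma>) n - dirichlet_term c (of_real \<sigma>) n)"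
    have cc: "dirichlet_abs_conv (\<lambda>n. c n * mult_ext (\<psi> w) n) (of_real \<sigma>)"
      by (rule dirichlet_abs_conv_dominated[OF c\<sigma>]) (auto simp: norm_mult nm[OF w])
    have hs: "(d has_sum h w - f0) {1..}"
      using has_sum_add[OF dirichlet_series_has_sum[OF cc] has_sum_uminusI[OF dirichlet_series_has_sum[OF c\<sigma>]]]
      by (simp add: d_def h_def f0_def)
    have zero: "d n = 0" if n: "n \<le> P" "n \<ge> 1" for n
    proof -
      have "p \<notin> A" if "p \<in> prime_factors n" for p
      proof -
        have "p \<le> n" using in_prime_factors_imp_dvd[OF that] n(2) by (simp add: dvd_imp_le)
        then show ?thesis using A(3)[of p] n(1) by linarith
      qed
      then have "mult_ext (\<psi> w) n = 1"
        unfolding mult_ext_def by (intro prod.neutral) (simp add: \<psi>_def)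
      then show ?thesis by (simp add: d_def dirichlet_term_def)
    qed
    have "(d has_sum h w - f0) {P<..}"
      using hs by (rule has_sum_cong_neutral[THEN iffD1, rotated -1]) (auto simp: not_less zero)
    moreover have "((\<lambda>n. 2 * q n) has_sum 2 * infsum q {P<..}) {P<..}"
      by (intro has_sum_cmult_right has_sum_infsum summable_on_subset[OF q(1)]) auto
    moreover have "norm (d n) \<le> 2 * q n" if "n \<in> {P<..}" for n
    proof -
      have n: "n \<ge> 1" using that by auto
      have "norm (d n) \<le> norm (c n) * real n powr (- \<sigma>) + norm (c n) * real n powr (- \<sigma>)"
        unfolding d_def using n
        by (intro norm_triangle_le_diff add_mono) (auto simp: norm_dirichlet_term norm_mult nm[OF w])
      also have "norm (c n) * real n powr (- \<sigma>) \<le> q n"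
        unfolding q_def using n \<sigma> by (intro mult_left_mono powr_mono) auto
      finally show ?thesis by simp
    qed
    ultimately have "norm (h w - f0) \<le> 2 * infsum q {P<..}"
      by (rule norm_infsum_le)
    then show ?thesis using tail by simp
  qed
  \<comment> \<open>The quotient of the twisted by the untwisted \<open>f\<close> stays in the disc of radius 1/2 around 1, where \<open>Ln\<close> is continuous.\<close>
  define z where "z = (\<lambda>w. h w / f0)"
  have z: "norm (z w - 1) \<le> 1 / 2" if "w \<in> cball 0 R" for w
  proof -
    have "norm (h w - f0) \<le> norm f0 / 2" using h[OF that] f0(1) by linarith
    moreover have "z w - 1 = (h w - f0) / f0" using f0nz by (simp add: z_def diff_divide_distrib)
    ultimately show ?thesis using f0nz by (simp add: norm_divide pos_divide_le_eq)
  qed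
  have zRe: "Re (z w) > 0" if "w \<in> cball 0 R" for w
    using z[OF that] abs_Re_le_cmod[of "z w - 1"] by auto
  have zn: "1 / 2 \<le> norm (z w)" "norm (z w) \<le> 3 / 2" if "w \<in> cball 0 R" for w
    using z[OF that] norm_triangle_ineq2[of 1 "z w"] norm_triangle_ineq2[of "z w" 1]
    by (auto simp: norm_minus_commute)
  define y where "y = (\<lambda>w. Ln (- f0) + Ln (z w))"
  have y: "norm (y w) \<le> B + 2 * pi + 1" if w: "w \<in> cball 0 R" for w
  proof -
    have "ln (norm f0) \<le> B" "- B \<le> ln (norm f0)"
      using f0 f0nz ln_le_cancel_iff[of "norm f0" "exp B"] ln_le_cancel_iff[of "exp (- B)" "norm f0"]
      by auto
    then have 1: "norm (Ln (- f0)) \<le> B + pi"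
      using norm_Ln_le[of "- f0"] f0nz by auto
    have "ln (norm (z w)) \<le> norm (z w) - 1" "ln (1 / norm (z w)) \<le> 1 / norm (z w) - 1"
      using zn[OF w] by (auto intro!: ln_le_minus_one simp del: norm_inverse)
    moreover have "1 / norm (z w) \<le> 2" using zn[OF w] by (simp add: divide_simps)
    moreover have "ln (1 / norm (z w)) = - ln (norm (z w))" using zn[OF w] by (simp add: ln_div)
    ultimately have "\<bar>ln (norm (z w))\<bar> \<le> 1" using zn[OF w] by linarith
    moreover have "z w \<noteq> 0" using zRe[OF w] by auto
    ultimately have "norm (Ln (z w)) \<le> 1 + pi" using norm_Ln_le[of "z w"] by linarith
    then show ?thesis using 1 unfolding y_def by (intro norm_triangle_le) linarith
  qed
  define \<Phi> where "\<Phi> = (\<lambda>w. (w - T w) + y w)"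
  have "continuous_on (cball 0 R) y"
    unfolding y_def z_def using zRe f0nz
    by (intro continuous_intros conth) (force simp: z_def complex_nonpos_Reals_iff)+
  then have cont\<Phi>: "continuous_on (cball 0 R) \<Phi>"
    unfolding \<Phi>_def by (intro continuous_intros contT)
  have "\<Phi> \<in> cball 0 R \<rightarrow> cball 0 R"
  proof
    fix w assume w: "w \<in> cball (0::complex) R"
    have "\<Phi> w = ((\<Sum>p\<in>A. of_real (r p) * e p w) - T w) - ((\<Sum>p\<in>A. of_real (r p) * e p w) - w) + y w"
      by (simp add: \<Phi>_def)
    also have "norm \<dots> \<le> ((C1 + C2 + 1) + 2 * K) + (B + 2 * pi + 1)"
      by (intro norm_triangle_le add_mono norm_triangle_le_diff T e(3) y w)
    finally show "\<Phi> w \<in> cball 0 R" by (simp add: R_def)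
  qed
  then obtain w where w: "w \<in> cball 0 R" "\<Phi> w = w"
    using brouwer[of "cball 0 R" \<Phi>] cont\<Phi> R by auto
  have "exp (T w) = exp (y w)" using w(2) by (simp add: \<Phi>_def algebra_simps)
  also have "\<dots> = (- f0) * z w"
  proof -
    have "z w \<noteq> 0" using zRe[OF w(1)] by auto
    then show ?thesis using f0nz by (simp add: y_def exp_add)
  qed
  also have "\<dots> = - h w" using f0nz by (simp add: z_def)
  finally have "exp (T w) + h w = 0" by simp
  then show ?thesis
    using \<sigma> unit[OF w(1)] unfolding T_def h_def by blast
qed

section \<open>Logarithms as series over prime powers\<close>

text \<open>
  The double series over primes and exponents as an ordinary Dirichlet series.
\<close>

definition prime_power_coeff :: "(nat \<Rightarrow> complex) \<Rightarrow> nat \<Rightarrow> complex" where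
  "prime_power_coeff b n = (if n \<in> (\<lambda>(p, k). p ^ k) ` prime_exponents then b n else 0)"

lemma inj_on_prime_exponents: "inj_on (\<lambda>(p, k). p ^ k) prime_exponents"
proof (rule inj_onI, clarify)
  fix p k p' k' :: nat
  assume "(p, k) \<in> prime_exponents" "(p', k') \<in> prime_exponents" and eq: "p ^ k = p' ^ k'"
  then have "prime p" "prime p'" "k \<ge> 1" "k' \<ge> 1" by (auto simp: prime_exponents_def)
  then show "p = p' \<and> k = k'" using prime_power_inj''[of p p' k k'] eq by auto
qed

lemma prime_exponents_image_ge_1: "(\<lambda>(p, k). p ^ k) ` prime_exponents \<subseteq> {1..}"
  by (auto simp: prime_exponents_def Suc_le_eq prime_gt_0_nat)

lemma log_term_eq_dirichlet_term:
  assumes "x \<in> prime_exponents"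
  shows "log_term b s x = dirichlet_term (prime_power_coeff b) s (case x of (p, k) \<Rightarrow> p ^ k)"
proof -
  obtain p k where x: "x = (p, k)" "prime p" "k \<ge> 1"
    using assms by (auto simp: prime_exponents_def)
  have "p ^ k \<in> (\<lambda>(p, k). p ^ k) ` prime_exponents"
    using assms x by (intro image_eqI[of _ _ x]) auto
  moreover have "of_nat (p ^ k) powr s = of_nat p powr (of_nat k * s)"
  proof -
    have "ln (real (p ^ k)) = real k * ln (real p)"
      using prime_gt_0_nat[OF x(2)] by (simp add: ln_realpow)
    then show ?thesis
      using prime_gt_0_nat[OF x(2)] by (simp add: of_nat_powr_eq_exp mult_ac del: of_nat_power)
  qed
  ultimately show ?thesis
    by (simp add: x log_term_def dirichlet_term_def prime_power_coeff_def)
qed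

lemma log_series_eq_dirichlet_series: "log_series b s = dirichlet_series (prime_power_coeff b) s"
proof -
  have "log_series b s = infsum (dirichlet_term (prime_power_coeff b) s) ((\<lambda>(p, k). p ^ k) ` prime_exponents)"
    unfolding log_series_def infsum_reindex[OF inj_on_prime_exponents] o_def
    by (rule infsum_cong) (rule log_term_eq_dirichlet_term)
  also have "\<dots> = dirichlet_series (prime_power_coeff b) s"
    unfolding dirichlet_series_def using prime_exponents_image_ge_1
    by (intro infsum_cong_neutral) (auto simp: dirichlet_term_def prime_power_coeff_def)
  finally show ?thesis .
qed

lemma log_abs_conv_imp_dirichlet_abs_conv:
  assumes "log_abs_conv b s"
  shows "dirichlet_abs_conv (prime_power_coeff b) s"
proof -
  have "(\<lambda>x. norm (dirichlet_term (prime_power_coeff b) s (case x of (p, k) \<Rightarrow> p ^ k))) summable_on prime_exponents"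
    using assms unfolding log_abs_conv_def
    by (rule summable_on_cong[THEN iffD1, rotated]) (simp add: log_term_eq_dirichlet_term)
  then have "(\<lambda>n. norm (dirichlet_term (prime_power_coeff b) s n)) summable_on ((\<lambda>(p, k). p ^ k) ` prime_exponents)"
    by (simp add: summable_on_reindex[OF inj_on_prime_exponents] o_def)
  then show ?thesis
    unfolding dirichlet_abs_conv_def
    by (rule summable_on_cong_neutral[THEN iffD1, rotated -1])
       (use prime_exponents_image_ge_1 in \<open>auto simp: dirichlet_term_def prime_power_coeff_def\<close>)
qed

lemma prime_power_coeff_prime:
  assumes "prime p"
  shows "prime_power_coeff b p = b p"
proof -
  have "p \<in> (\<lambda>(p, k). p ^ k) ` prime_exponents"
    using assms by (intro image_eqI[of _ _ "(p, 1)"]) (auto simp: prime_exponents_def)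
  then show ?thesis by (simp add: prime_power_coeff_def)
qed

lemma prime_power_coeff_1: "prime_power_coeff b 1 = 0"
proof -
  have "1 \<notin> (\<lambda>(p, k). p ^ k) ` prime_exponents"
  proof
    assume "1 \<in> (\<lambda>(p, k). p ^ k) ` prime_exponents"
    then obtain p k :: nat where "1 = p ^ k" "prime p" "k \<ge> 1"
      by (auto simp: prime_exponents_def)
    then show False using prime_power_eq_one_iff[of p k] by auto
  qed
  then show ?thesis by (simp add: prime_power_coeff_def)
qed

text \<open>
  On a proper prime power \<open>p ^ k\<close> the terms are at most
  \<open>K * p powr (k * (\<theta> - 1)) \<le> K * p powr (2 * (\<theta> - 1)) * \<rho> ^ (k - 2)\<close> with \<open>\<rho> = 2 powr (\<theta> - 1) < 1\<close>.
  The sum over \<open>p\<close> converges as \<open>2 * (\<theta> - 1) < - 1\<close>.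
\<close>

lemma summable_higher_prime_powers:
  assumes \<theta>: "\<theta> < 1 / 2"
    and b: "\<And>p k. prime p \<Longrightarrow> k \<ge> 1 \<Longrightarrow> norm (b (p ^ k)) \<le> K * real p powr (real k * \<theta>)"
  shows "(\<lambda>n. norm (prime_power_coeff b n) * real n powr (- 1)) summable_on {n. n \<ge> 1 \<and> \<not> prime n}"
proof -
  define \<rho> where "\<rho> = (2::real) powr (\<theta> - 1)"
  have \<rho>: "0 < \<rho>" "\<rho> < 1" using \<theta> by (simp_all add: \<rho>_def powr_less_one)
  have K: "K \<ge> 0"
    using order_trans[OF norm_ge_zero b[of 2 1]] by (simp add: zero_le_mult_iff)
  let ?I = "{p::nat. prime p} \<times> {2::nat..}"
  have sub: "?I \<subseteq> prime_exponents" by (auto simp: prime_exponents_def)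
  have s1: "(\<lambda>p. real p powr (2 * (\<theta> - 1))) summable_on {p. prime p}"
  proof -
    have "summable (\<lambda>n. real n powr (2 * (\<theta> - 1)))"
      using \<theta> by (simp add: summable_real_powr_iff)
    then have "(\<lambda>n. real n powr (2 * (\<theta> - 1))) summable_on UNIV"
      by (intro summable_nonneg_imp_summable_on) auto
    then show ?thesis by (rule summable_on_subset) auto
  qed
  have s2: "(\<lambda>k. \<rho> ^ (k - 2)) summable_on {2..}"
  proof -
    have "(\<lambda>k. \<rho> ^ k) summable_on UNIV"
      using \<rho> by (intro summable_nonneg_imp_summable_on) (auto simp: summable_geometric_iff)
    moreover have "bij_betw (\<lambda>k. k - 2) {2..} (UNIV :: nat set)"
      by (rule bij_betwI[of _ _ _ "\<lambda>k. k + 2"]) auto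
    ultimately show ?thesis using summable_on_reindex_bij_betw by blast
  qed
  have "(\<lambda>x. norm (case x of (p, k) \<Rightarrow> real p powr (2 * (\<theta> - 1)) * \<rho> ^ (k - 2))) summable_on ?I"
    by (rule has_sum_product_abs(2)[OF has_sum_infsum[OF s1] _ has_sum_infsum[OF s2]])
       (use s1 s2 \<rho> in simp_all)
  then have s3: "(\<lambda>x. K * norm (case x of (p, k) \<Rightarrow> real p powr (2 * (\<theta> - 1)) * \<rho> ^ (k - 2))) summable_on ?I"
    by (rule summable_on_cmult_right)
  have "(\<lambda>x. norm (prime_power_coeff b (case x of (p, k) \<Rightarrow> p ^ k)) * real (case x of (p, k) \<Rightarrow> p ^ k) powr (- 1)) summable_on ?I"
  proof (rule summable_on_comparison_test[OF s3])
    fix x assume "x \<in> ?I"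
    then obtain p k where x: "x = (p, k)" "prime p" "k \<ge> 2" by auto
    then have pk: "p ^ k \<in> (\<lambda>(p, k). p ^ k) ` prime_exponents"
      using sub \<open>x \<in> ?I\<close> by (intro image_eqI[of _ _ x]) auto
    have p: "real p \<ge> 2" using prime_ge_2_nat[OF x(2)] by simp
    have "norm (b (p ^ k)) * real (p ^ k) powr (- 1) \<le> K * real p powr (real k * \<theta>) * real (p ^ k) powr (- 1)"
      using x by (intro mult_right_mono b) auto
    also have "real (p ^ k) powr (- 1) = real p powr (- real k)"
      using p by (simp add: powr_minus powr_realpow)
    also have "K * real p powr (real k * \<theta>) * real p powr (- real k) = K * (real p powr (real k * (\<theta> - 1)))"
      by (simp add: algebra_simps flip: powr_add)
    also have "real k * (\<theta> - 1) = 2 * (\<theta> - 1) + real (k - 2) * (\<theta> - 1)"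
      using x(3) by (simp add: algebra_simps of_nat_diff)
    also have "real p powr (2 * (\<theta> - 1) + real (k - 2) * (\<theta> - 1)) =
        real p powr (2 * (\<theta> - 1)) * (real p powr (\<theta> - 1)) ^ (k - 2)"
      using p by (simp add: powr_add powr_power mult.commute)
    also have "K * (real p powr (2 * (\<theta> - 1)) * (real p powr (\<theta> - 1)) ^ (k - 2)) \<le> K * (real p powr (2 * (\<theta> - 1)) * \<rho> ^ (k - 2))"
      unfolding \<rho>_def using K p \<theta> by (intro mult_left_mono power_mono powr_mono2') auto
    finally show "norm (prime_power_coeff b (case x of (p, k) \<Rightarrow> p ^ k)) * real (case x of (p, k) \<Rightarrow> p ^ k) powr (- 1)
        \<le> K * norm (case x of (p, k) \<Rightarrow> real p powr (2 * (\<theta> - 1)) * \<rho> ^ (k - 2))"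
      using pk \<rho> p by (simp add: x prime_power_coeff_def powr_minus powr_realpow divide_inverse)
  qed auto
  then have "(\<lambda>n. norm (prime_power_coeff b n) * real n powr (- 1)) summable_on ((\<lambda>(p, k). p ^ k) ` ?I)"
    by (subst summable_on_reindex[OF inj_on_subset[OF inj_on_prime_exponents sub]]) (simp add: o_def)
  then show ?thesis
  proof (rule summable_on_cong_neutral[THEN iffD1, rotated -1])
    fix n assume n: "n \<in> {n. n \<ge> 1 \<and> \<not> prime n} - (\<lambda>(p, k). p ^ k) ` ?I"
    have "n \<notin> (\<lambda>(p, k). p ^ k) ` prime_exponents"
    proof
      assume "n \<in> (\<lambda>(p, k). p ^ k) ` prime_exponents"
      then obtain p k where pk: "n = p ^ k" "prime p" "k \<ge> 1" by (auto simp: prime_exponents_def)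
      then have "k \<noteq> 1" using n by auto
      then have "(p, k) \<in> ?I" using pk by auto
      then show False using n pk(1) by (auto intro: image_eqI[of _ _ "(p, k)"])
    qed
    then show "norm (prime_power_coeff b n) * real n powr (- 1) = 0" by (simp add: prime_power_coeff_def)
  next
    fix n assume n: "n \<in> (\<lambda>(p, k). p ^ k) ` ?I - {n. n \<ge> 1 \<and> \<not> prime n}"
    then obtain p k where pk: "n = p ^ k" "prime p" "k \<ge> 2" by auto
    then have "n \<ge> 1" "\<not> prime n" using prime_ge_1_nat[of p] by (auto simp: prime_power_iff)
    then show "norm (prime_power_coeff b n) * real n powr (- 1) = 0" using n by auto
  qed auto
qed

section \<open>Infinitely many zeros\<close>

theorem theorem2:
  fixes a b c :: "nat \<Rightarrow> complex" and L f :: "complex \<Rightarrow> complex"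
  assumes f_abs_conv: "\<And>s. Re s \<ge> 1 \<Longrightarrow> dirichlet_abs_conv c s"
    and f_series: "\<And>s. Re s \<ge> 1 \<Longrightarrow> f s = dirichlet_series c s"
    and f_log: "has_bounded_log_on f {s. Re s \<ge> 1}"
    and L_abs_conv: "\<And>s. Re s > 1 \<Longrightarrow> dirichlet_abs_conv a s"
    and L_series: "\<And>s. Re s > 1 \<Longrightarrow> L s = dirichlet_series a s"
    and log_L_abs_conv: "\<And>s. Re s > 1 \<Longrightarrow> log_abs_conv b s"
    and log_L_series: "\<And>s. Re s > 1 \<Longrightarrow> L s = exp (log_series b s)"
    and b_bound: "\<exists>K \<theta>. K > 0 \<and> \<theta> < 1 / 2 \<and>
      (\<forall>p k. prime p \<longrightarrow> k \<ge> 1 \<longrightarrow> norm (b (p ^ k)) \<le> K * real p powr (real k * \<theta>))"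
    and a_primes_diverge: "filterlim
      (\<lambda>\<sigma>. \<Sum>\<^sub>\<infinity>p\<in>{p. prime p}. norm (a p) * real p powr (- \<sigma>)) at_top (at_right 1)"
  shows "infinite {s. Re s > 1 \<and> L s + f s = 0}"
proof -
  let ?\<beta> = "prime_power_coeff b"
  have \<beta>: "dirichlet_abs_conv ?\<beta> s" if "Re s > 1" for s
    by (rule log_abs_conv_imp_dirichlet_abs_conv[OF log_L_abs_conv[OF that]])
  have a_exp: "dirichlet_series a s = exp (dirichlet_series ?\<beta> s)" if "Re s > 1" for s
    using L_series[OF that] log_L_series[OF that] by (simp add: log_series_eq_dirichlet_series)
  have a_prime: "a p = ?\<beta> p" if "prime p" for p
    by (rule coeff_prime_of_exp[OF L_abs_conv \<beta> prime_power_coeff_1 a_exp that])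
  obtain K \<theta> where K\<theta>: "K > 0" "\<theta> < 1 / 2"
    and b: "\<And>p k. prime p \<Longrightarrow> k \<ge> 1 \<Longrightarrow> norm (b (p ^ k)) \<le> K * real p powr (real k * \<theta>)"
    using b_bound by blast
  obtain g B where g: "\<And>s. Re s \<ge> 1 \<Longrightarrow> exp (g s) = f s" "\<And>s. Re s \<ge> 1 \<Longrightarrow> norm (g s) \<le> B"
    using f_log unfolding has_bounded_log_on_def by auto
  have f_bounds: "exp (- B) \<le> norm (dirichlet_series c (of_real x))"
      "norm (dirichlet_series c (of_real x)) \<le> exp B" if "x \<ge> 1" for x
  proof -
    have x: "Re (complex_of_real x) \<ge> 1" using that by simp
    have "norm (dirichlet_series c (of_real x)) = exp (Re (g (of_real x)))"
      using f_series[OF x] g(1)[OF x] by (metis norm_exp_eq_Re)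
    moreover have "\<bar>Re (g (of_real x))\<bar> \<le> B"
      using abs_Re_le_cmod g(2)[OF x] by (rule order_trans)
    ultimately show "exp (- B) \<le> norm (dirichlet_series c (of_real x))"
      "norm (dirichlet_series c (of_real x)) \<le> exp B" by auto
  qed
  have bound: "norm (?\<beta> p) \<le> K * real p" if p: "prime p" for p
  proof -
    have "norm (?\<beta> p) \<le> K * real p powr \<theta>"
      using b[OF p, of 1] by (simp add: prime_power_coeff_prime[OF p])
    also have "\<dots> \<le> K * real p powr 1"
      using K\<theta> prime_ge_1_nat[OF p] by (intro mult_left_mono powr_mono) auto
    finally show ?thesis using prime_gt_0_nat[OF p] by simp
  qed
  have unbounded: "\<exists>\<sigma>>1. Q \<le> infsum (\<lambda>p. norm (a p) * real p powr (- \<sigma>)) {p. prime p}" for Q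
  proof -
    have "\<forall>\<^sub>F \<sigma> in at_right 1. Q \<le> infsum (\<lambda>p. norm (a p) * real p powr (- \<sigma>)) {p. prime p} \<and> \<sigma> > 1"
      using a_primes_diverge eventually_at_right_less
      by (intro eventually_conj) (auto simp: filterlim_at_top)
    then show ?thesis using eventually_happens'[OF trivial_limit_at_right_real] by blast
  qed
  have "infsum (\<lambda>p. norm (a p) * real p powr (- \<sigma>)) {p. prime p} =
      infsum (\<lambda>p. norm (?\<beta> p) * real p powr (- \<sigma>)) {p. prime p}" for \<sigma>
    by (rule infsum_cong) (simp add: a_prime)
  then have unbounded': "\<exists>\<sigma>>1. Q \<le> infsum (\<lambda>p. norm (?\<beta> p) * real p powr (- \<sigma>)) {p. prime p}" for Q
    using unbounded by simp
  have c1: "dirichlet_abs_conv c 1" by (rule f_abs_conv) simp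
  obtain \<psi> \<sigma> where \<psi>: "\<And>p. prime p \<Longrightarrow> norm (\<psi> p) = 1" and \<sigma>: "\<sigma> > 1"
    and zero: "exp (dirichlet_series (\<lambda>n. ?\<beta> n * mult_ext \<psi> n) (of_real \<sigma>)) +
      dirichlet_series (\<lambda>n. c n * mult_ext \<psi> n) (of_real \<sigma>) = 0"
    using twisted_sum_has_zero[OF c1 f_bounds \<beta> summable_higher_prime_powers[OF K\<theta>(2) b] bound unbounded']
    by blast
  have a\<sigma>: "dirichlet_abs_conv a (of_real \<sigma>)" and c\<sigma>: "dirichlet_abs_conv c (of_real \<sigma>)"
    using L_abs_conv[of "of_real \<sigma>"] f_abs_conv[of "of_real \<sigma>"] \<sigma> by auto
  have tw: "dirichlet_abs_conv (\<lambda>n. u n * mult_ext \<psi> n) (of_real \<sigma>)" if "dirichlet_abs_conv u (of_real \<sigma>)" for u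
    by (rule dirichlet_abs_conv_dominated[OF that]) (auto simp: norm_mult norm_mult_ext[of \<psi>, OF \<psi>])
  have "dirichlet_series (\<lambda>n. a n * mult_ext \<psi> n + c n * mult_ext \<psi> n) (of_real \<sigma>) = 0"
    using zero \<sigma> dirichlet_series_add[OF tw[OF a\<sigma>] tw[OF c\<sigma>]]
      twisted_dirichlet_series_eq_exp[of \<psi> a ?\<beta> "of_real \<sigma>", OF \<psi> L_abs_conv \<beta> a_exp]
    by simp
  then have zero': "dirichlet_series (\<lambda>n. (a n + c n) * mult_ext \<psi> n) (of_real \<sigma>) = 0"
    by (simp add: distrib_right)
  have conv: "dirichlet_abs_conv (\<lambda>n. a n + c n) s" if "Re s > 1" for s
    using that by (intro dirichlet_abs_conv_add L_abs_conv f_abs_conv) auto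
  have "\<exists>m\<ge>1. a m + c m \<noteq> 0"
  proof (rule ccontr)
    assume "\<not> (\<exists>m\<ge>1. a m + c m \<noteq> 0)"
    then have ac: "norm (a m) = norm (c m)" if "m \<ge> 1" for m
      using that by (metis add_eq_0_iff norm_minus_cancel)
    define C where "C = infsum (\<lambda>n. norm (c n) * real n powr (- 1)) {1..}"
    have c1': "(\<lambda>n. norm (c n) * real n powr (- 1)) summable_on {1..}"
      using c1 by (simp add: dirichlet_abs_conv_iff)
    have pr: "{p::nat. prime p} \<subseteq> {1..}" using prime_ge_1_nat by auto
    obtain x where x: "x > 1" and big: "C + 1 \<le> infsum (\<lambda>p. norm (a p) * real p powr (- x)) {p. prime p}"
      using unbounded by blast
    have "infsum (\<lambda>p. norm (a p) * real p powr (- x)) {p. prime p} \<le> C"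
      unfolding C_def
    proof (rule infsum_mono_neutral)
      have "(\<lambda>n. norm (a n) * real n powr (- x)) summable_on {1..}"
        using L_abs_conv[of "of_real x"] x by (simp add: dirichlet_abs_conv_iff)
      then show "(\<lambda>n. norm (a n) * real n powr (- x)) summable_on {p. prime p}"
        using pr by (rule summable_on_subset)
      show "norm (a p) * real p powr (- x) \<le> norm (c p) * real p powr (- 1)"
        if "p \<in> {p. prime p} \<inter> {1..}" for p
        using that x ac[of p] by (intro mult_mono powr_mono) auto
    qed (use c1' pr in auto)
    then show False using big by linarith
  qed
  then obtain m where "m \<ge> 1" "a m + c m \<noteq> 0" by blast
  then have inf: "infinite {s. Re s > 1 \<and> dirichlet_series (\<lambda>n. a n + c n) s = 0}"
    using infinite_zeros_of_twisted_zero[of \<psi> "\<lambda>n. a n + c n" m "of_real \<sigma>"] \<psi> conv \<sigma> zero' by simp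
  have "L s + f s = dirichlet_series (\<lambda>n. a n + c n) s" if "Re s > 1" for s
    using that dirichlet_series_add[OF L_abs_conv f_abs_conv, of s] by (simp add: L_series f_series)
  then have "{s. Re s > 1 \<and> L s + f s = 0} = {s. Re s > 1 \<and> dirichlet_series (\<lambda>n. a n + c n) s = 0}"
    by auto
  then show ?thesis using inf by simp
qed

end
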